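(* Let $k,l$ be relatively prime positive integers, let $P(z)=(3-z^{k}-z^{-k})(3-z^{l}-z^{-l})-1$, and set $$A_{k,l}=\prod_{P(z)=0,\ |z|>1}|z|,$$ the product being over the complex roots of $P$ of modulus greater than $1$, counted with multiplicity. Then the number $\tau_{k,l}(n)$ of spanning trees of the $I$-graph $I(n,k,l)$ satisfies $$\tau_{k,l}(n)\sim \frac{n}{k^2+l^2}\,A_{k,l}^{\,n}\qquad (n\to\infty),$$ i.e. the ratio of the two sides tends to $1$.
   Context: The $I$-graph $I(n,k,l)$ is the multigraph with vertex set $\{u_i,v_i : i\in\mathbb{Z}/n\}$ and with edges $u_iu_{i+l}$, $u_iv_i$, $v_iv_{i+k}$, one of each kind for every $i\in\mathbb{Z}/n$ (subscripts modulo $n$; $3n$ edges in total). For $n>\max(k,l)$ it has no loops and is $3$-valent; multiple edges are allowed. *)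

theory Defs
  imports "HOL-Complex_Analysis.Complex_Analysis" "HOL-Library.Landau_Symbols"
begin

section \<open>Undirected multigraphs and their spanning trees\<close>

text \<open>
  Edges are named objects, so parallel edges are distinct. The set of end points of an edge has
  two elements, or just one if the edge is a loop.
\<close>

record ('v, 'e) multigraph =
  mverts :: "'v set"
  medges :: "'e set"
  mends :: "'e \<Rightarrow> 'v set"

definition madjacent :: "('v, 'e) multigraph \<Rightarrow> ('v \<times> 'v) set" where
  "madjacent G = {(x, y). x \<in> mverts G \<and> y \<in> mverts G \<and> (\<exists>e\<in>medges G. mends G e = {x, y})}"

definition mconnected :: "('v, 'e) multigraph \<Rightarrow> bool" where
  "mconnected G \<longleftrightarrow>
     mverts G \<noteq> {} \<and> (\<forall>x\<in>mverts G. \<forall>y\<in>mverts G. (x, y) \<in> (madjacent G)\<^sup>*)"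

text \<open>
  The cycle visits the vertices \<open>vs ! 0, vs ! 1, \<dots>\<close> and returns to \<open>vs ! 0\<close>. A loop is a cycle of
  length 1 and a pair of parallel edges a cycle of length 2; \<open>distinct es\<close> keeps a single edge
  traversed back and forth from counting as a cycle.
\<close>

definition mcycle :: "('v, 'e) multigraph \<Rightarrow> 'v list \<Rightarrow> 'e list \<Rightarrow> bool" where
  "mcycle G vs es \<longleftrightarrow>
     vs \<noteq> [] \<and> length es = length vs \<and>
     distinct vs \<and> set vs \<subseteq> mverts G \<and> distinct es \<and> set es \<subseteq> medges G \<and>
     (\<forall>i<length vs. mends G (es ! i) = {vs ! i, vs ! (Suc i mod length vs)})"

definition mtree :: "('v, 'e) multigraph \<Rightarrow> bool" where
  "mtree G \<longleftrightarrow> mconnected G \<and> (\<nexists>vs es. mcycle G vs es)"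

text \<open>A spanning subgraph is identified with its set of edges.\<close>

definition spanning_trees :: "('v, 'e) multigraph \<Rightarrow> 'e set set" where
  "spanning_trees G = {T. T \<subseteq> medges G \<and> mtree (G\<lparr>medges := T\<rparr>)}"

section \<open>I-graphs\<close>

text \<open>Residues modulo \<open>n\<close> are represented by \<open>{..<n}\<close>.\<close>

datatype ivertex = Uvert nat | Vvert nat

datatype iedge = EU nat | ES nat | EV nat

primrec iends :: "nat \<Rightarrow> nat \<Rightarrow> nat \<Rightarrow> iedge \<Rightarrow> ivertex set" where
  "iends n k l (EU i) = {Uvert i, Uvert ((i + l) mod n)}"
| "iends n k l (ES i) = {Uvert i, Vvert i}"
| "iends n k l (EV i) = {Vvert i, Vvert ((i + k) mod n)}"

definition I_graph :: "nat \<Rightarrow> nat \<Rightarrow> nat \<Rightarrow> (ivertex, iedge) multigraph" where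
  "I_graph n k l =
     \<lparr>mverts = Uvert ` {..<n} \<union> Vvert ` {..<n},
      medges = EU ` {..<n} \<union> ES ` {..<n} \<union> EV ` {..<n},
      mends = iends n k l\<rparr>"

definition tau :: "nat \<Rightarrow> nat \<Rightarrow> nat \<Rightarrow> nat" where
  "tau k l n = card (spanning_trees (I_graph n k l))"

lemma card_medges_I_graph: "card (medges (I_graph n k l)) = 3 * n"
proof -
  have "card (EU ` {..<n} \<union> ES ` {..<n} \<union> EV ` {..<n}) =
      card (EU ` {..<n}) + card (ES ` {..<n}) + card (EV ` {..<n})"
    by (subst card_Un_disjoint; (subst card_Un_disjoint)?) auto
  also have "\<dots> = 3 * n"
    by (simp add: card_image inj_on_def)
  finally show ?thesis
    by (simp add: I_graph_def)
qed

lemma mends_I_graph_subset: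
  assumes "e \<in> medges (I_graph n k l)"
  shows "mends (I_graph n k l) e \<subseteq> mverts (I_graph n k l)"
  using assms by (auto simp: I_graph_def)

section \<open>The Laurent polynomial and its roots outside the unit disc\<close>

definition P_laurent :: "nat \<Rightarrow> nat \<Rightarrow> complex \<Rightarrow> complex" where
  "P_laurent k l z =
     (3 - z ^ k - z powi (- int k)) * (3 - z ^ l - z powi (- int l)) - 1"

text \<open>\<open>zorder (P_laurent k l) z\<close> is the multiplicity of the root \<open>z\<close>.\<close>

definition A_const :: "nat \<Rightarrow> nat \<Rightarrow> real" where
  "A_const k l = (\<Prod>z | P_laurent k l z = 0 \<and> norm z > 1. norm z powi zorder (P_laurent k l) z)"

end

theory Submission
  imports Defs "Jordan_Normal_Form.Determinant"
    "HOL-Computational_Algebra.Fundamental_Theorem_Algebra"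
begin

text \<open>
  The spanning trees are counted by Kirchhoff's theorem, in the form that \<open>det (L + x I) / x\<close> tends
  to \<open>N * \<tau>\<close> as \<open>x\<close> tends to 0. Here \<open>L\<close> is the Laplacian of a multigraph with \<open>N\<close> vertices and \<open>\<tau>\<close>
  spanning trees (\<open>matrix_tree\<close>). This form suits a graph with a cyclic symmetry: in contrast to the
  Laplacian with one row and one column deleted, \<open>L + x I\<close> is still invariant under rotation.

  To prove it, one writes \<open>L + x I\<close> as a sum of weighted rank-one matrices, one for each edge and one
  of weight \<open>x\<close> for each vertex, and expands the determinant as in the Cauchy--Binet formula
  (\<open>det_rank_one_sum_expand\<close>). A term belongs to a set of edges together with a set of roots, and the
  power of \<open>x\<close> is the number of roots. Without a root the term vanishes. With one root it is 1 if the
  \<open>N - 1\<close> chosen edges connect the graph, because then the chosen vectors generate the lattice of all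
  integer vectors, and 0 if they do not. So the coefficient of \<open>x\<close> counts the pairs of a
  spanning tree and a vertex.

  For the I-graph, \<open>L + x I\<close> consists of four circulant blocks, which the discrete Fourier transform
  diagonalises simultaneously. With \<open>\<omega>\<close> running over the \<open>n\<close>-th roots of unity other than 1, this gives
  \<open>n * \<tau>(n) = (\<Prod>\<omega>. P(\<omega>))\<close> (\<open>tau_eq_prod\<close>).

  Finally, \<open>z ^ (k + l) * P(z) = (z - 1)\<^sup>2 * R(z)\<close> for a monic polynomial \<open>R\<close> that has no roots on the
  unit circle and satisfies \<open>R(1) = -(k\<^sup>2 + l\<^sup>2)\<close>. The product over \<open>\<omega>\<close> turns \<open>(z - 1)\<^sup>2\<close> into \<open>n\<^sup>2\<close> and each
  root \<open>r\<close> of \<open>R\<close> into \<open>(r ^ n - 1) / (r - 1)\<close> up to a sign. Asymptotically the numerators contribute the factor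
  \<open>A ^ n\<close>, coming from the roots outside the unit disc, while the denominators multiply to \<open>R(1)\<close>
  up to a sign, which produces \<open>k\<^sup>2 + l\<^sup>2\<close>.
\<close>

hide_const (open) Determinants.det Finite_Cartesian_Product.mat Finite_Cartesian_Product.vec
  Finite_Cartesian_Product.row

section \<open>The determinant of a sum of rank-one matrices\<close>

definition rank_one_sum :: "nat \<Rightarrow> ('i \<Rightarrow> 'a) \<Rightarrow> ('i \<Rightarrow> nat \<Rightarrow> 'a) \<Rightarrow> ('i \<Rightarrow> nat \<Rightarrow> 'a :: comm_ring_1) \<Rightarrow> 'i set \<Rightarrow> 'a mat" where
  "rank_one_sum N w a b I = mat N N (\<lambda>(r, c). \<Sum>i\<in>I. w i * a i r * b i c)"

lemma rank_one_sum_carrier [simp]: "rank_one_sum N w a b I \<in> carrier_mat N N"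
  by (simp add: rank_one_sum_def)

text \<open>Multilinearity in the rows: a map \<open>f\<close> records which summand is taken in which row.\<close>
lemma det_rank_one_sum_maps:
  fixes a b :: "'i \<Rightarrow> nat \<Rightarrow> 'a :: comm_ring_1"
  assumes "finite I"
  shows "det (rank_one_sum N w a b I) = (\<Sum>f \<in> {0..<N} \<rightarrow>\<^sub>E I.
           (\<Prod>r\<in>{0..<N}. w (f r) * a (f r) r) * det (mat N N (\<lambda>(r, c). b (f r) c)))"
proof -
  have "det (rank_one_sum N w a b I) = (\<Sum>p | p permutes {0..<N}. signof p * (\<Prod>r = 0..<N. \<Sum>i\<in>I. w i * a i r * b i (p r)))"
    by (subst det_def'[OF rank_one_sum_carrier], rule sum.cong)
       (auto simp: rank_one_sum_def permutes_in_image intro!: prod.cong)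
  also have "\<dots> = (\<Sum>p | p permutes {0..<N}. signof p * 
      (\<Sum>f \<in> {0..<N} \<rightarrow>\<^sub>E I. (\<Prod>r = 0..<N. w (f r) * a (f r) r * b (f r) (p r))))"
    using assms by (simp add: prod_sum_PiE)
  also have "\<dots> = (\<Sum>f \<in> {0..<N} \<rightarrow>\<^sub>E I. \<Sum>p | p permutes {0..<N}. 
      signof p * (\<Prod>r = 0..<N. w (f r) * a (f r) r * b (f r) (p r)))"
    by (simp add: sum_distrib_left sum.swap[of _ "{p. p permutes {0..<N}}"])
  also have "\<dots> = (\<Sum>f \<in> {0..<N} \<rightarrow>\<^sub>E I. (\<Prod>r\<in>{0..<N}. w (f r) * a (f r) r) * 
      (\<Sum>p | p permutes {0..<N}. signof p * (\<Prod>r = 0..<N. b (f r) (p r))))"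
    by (simp add: sum_distrib_left prod.distrib mult_ac)
  also have "\<dots> = (\<Sum>f \<in> {0..<N} \<rightarrow>\<^sub>E I. (\<Prod>r\<in>{0..<N}. w (f r) * a (f r) r) *
      det (mat N N (\<lambda>(r, c). b (f r) c)))"
    by (intro sum.cong arg_cong2[where f = "(*)"] refl, subst det_def'[of _ N])
       (auto simp: permutes_in_image intro!: sum.cong prod.cong)
  finally show ?thesis .
qed

text \<open>If the same summand is taken in two rows, these rows are proportional.\<close>
lemma det_rank_one_sum_inj_maps:
  fixes a b :: "'i \<Rightarrow> nat \<Rightarrow> 'a :: comm_ring_1"
  assumes "finite I"
  shows "det (rank_one_sum N w a b I) = (\<Sum>f | f \<in> {0..<N} \<rightarrow>\<^sub>E I \<and> inj_on f {0..<N}.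
           (\<Prod>i\<in>f ` {0..<N}. w i) * (\<Prod>r\<in>{0..<N}. a (f r) r) * det (mat N N (\<lambda>(r, c). b (f r) c)))"
proof -
  have "det (mat N N (\<lambda>(r, c). b (f r) c)) = 0" if not_inj: "\<not> inj_on f {0..<N}" for f :: "nat \<Rightarrow> 'i"
  proof -
    obtain r s where "r < N" "s < N" "r \<noteq> s" "f r = f s"
      using not_inj by (auto simp: inj_on_def)
    then show ?thesis
      by (intro det_identical_rows[where n = N and i = r and j = s]) auto
  qed
  note repeated = this
  show ?thesis
    unfolding det_rank_one_sum_maps[OF assms]
  proof (rule sum.mono_neutral_cong_right)
    show "finite ({0..<N} \<rightarrow>\<^sub>E I)"
      using assms by (simp add: finite_PiE)
    show "\<forall>f \<in> ({0..<N} \<rightarrow>\<^sub>E I) - {f. f \<in> {0..<N} \<rightarrow>\<^sub>E I \<and> inj_on f {0..<N}}.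
        (\<Prod>r\<in>{0..<N}. w (f r) * a (f r) r) * det (mat N N (\<lambda>(r, c). b (f r) c)) = 0"
    proof
      fix f assume "f \<in> ({0..<N} \<rightarrow>\<^sub>E I) - {f. f \<in> {0..<N} \<rightarrow>\<^sub>E I \<and> inj_on f {0..<N}}"
      then have "\<not> inj_on f {0..<N}" by blast
      from repeated[OF this]
      show "(\<Prod>r\<in>{0..<N}. w (f r) * a (f r) r) * det (mat N N (\<lambda>(r, c). b (f r) c)) = 0"
        by (rule ssubst) simp
    qed
  next
    fix f assume "f \<in> {f. f \<in> {0..<N} \<rightarrow>\<^sub>E I \<and> inj_on f {0..<N}}"
    then have "inj_on f {0..<N}" by blast
    then have "(\<Prod>r\<in>{0..<N}. w (f r) * a (f r) r) = (\<Prod>i\<in>f ` {0..<N}. w i) * (\<Prod>r\<in>{0..<N}. a (f r) r)"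
      by (simp add: prod.distrib prod.reindex)
    then show "(\<Prod>r\<in>{0..<N}. w (f r) * a (f r) r) * det (mat N N (\<lambda>(r, c). b (f r) c)) =
       (\<Prod>i\<in>f ` {0..<N}. w i) * (\<Prod>r\<in>{0..<N}. a (f r) r) * det (mat N N (\<lambda>(r, c). b (f r) c))"
      by (rule arg_cong)
  qed blast
qed

text \<open>
  The Cauchy--Binet formula without square factors: instead of \<open>det A * det B\<close> for the two
  submatrices selected by \<open>S\<close>, the sum has the determinant of the partial sum over \<open>S\<close>. No order has
  to be put on the index set. The proof groups the injective maps by their images and applies
  the expansion once more to each partial sum.
\<close>
lemma det_rank_one_sum_expand:
  fixes a b :: "'i \<Rightarrow> nat \<Rightarrow> 'a :: comm_ring_1"
  assumes I: "finite I"
  shows "det (rank_one_sum N w a b I) =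
    (\<Sum>S | S \<subseteq> I \<and> card S = N. (\<Prod>i\<in>S. w i) * det (rank_one_sum N (\<lambda>_. 1) a b S))"
proof -
  let ?inj = "\<lambda>S. {f. f \<in> {0..<N} \<rightarrow>\<^sub>E S \<and> inj_on f {0..<N}}"
  let ?D = "\<lambda>f. (\<Prod>r\<in>{0..<N}. a (f r) r) * det (mat N N (\<lambda>(r, c). b (f r) c))"
  have fin: "finite (?inj I)"
    using I by (intro finite_subset[of "?inj I" "{0..<N} \<rightarrow>\<^sub>E I"] finite_PiE) auto
  have fibre: "{f \<in> ?inj I. f ` {0..<N} = S} = ?inj S" if "S \<subseteq> I" "card S = N" for S
  proof -
    have "f ` {0..<N} = S" if "f \<in> {0..<N} \<rightarrow>\<^sub>E S" "inj_on f {0..<N}" for f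
      using that \<open>card S = N\<close> finite_subset[OF \<open>S \<subseteq> I\<close> I]
      by (intro card_subset_eq) (auto simp: card_image)
    then show ?thesis
      using that by (auto simp: PiE_iff)
  qed
  have "det (rank_one_sum N w a b I) = (\<Sum>f \<in> ?inj I. (\<Prod>i\<in>f ` {0..<N}. w i) * ?D f)"
    unfolding det_rank_one_sum_inj_maps[OF I] by (simp add: mult.assoc)
  also have "\<dots> = (\<Sum>S | S \<subseteq> I \<and> card S = N. \<Sum>f \<in> {f \<in> ?inj I. f ` {0..<N} = S}. (\<Prod>i\<in>f ` {0..<N}. w i) * ?D f)"
    using fin I by (intro sum.group[symmetric]) (auto simp: card_image)
  also have "\<dots> = (\<Sum>S | S \<subseteq> I \<and> card S = N. (\<Prod>i\<in>S. w i) * (\<Sum>f \<in> ?inj S. ?D f))"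
  proof (intro sum.cong refl)
    fix S assume "S \<in> {S. S \<subseteq> I \<and> card S = N}"
    then have S: "S \<subseteq> I" "card S = N" by auto
    have "(\<Sum>f \<in> {f \<in> ?inj I. f ` {0..<N} = S}. (\<Prod>i\<in>f ` {0..<N}. w i) * ?D f) =
        (\<Sum>f \<in> {f \<in> ?inj I. f ` {0..<N} = S}. (\<Prod>i\<in>S. w i) * ?D f)"
      by (intro sum.cong) auto
    then show "(\<Sum>f \<in> {f \<in> ?inj I. f ` {0..<N} = S}. (\<Prod>i\<in>f ` {0..<N}. w i) * ?D f) =
        (\<Prod>i\<in>S. w i) * (\<Sum>f \<in> ?inj S. ?D f)"
      by (simp only: fibre[OF S] sum_distrib_left)
  qed
  also have "\<dots> = (\<Sum>S | S \<subseteq> I \<and> card S = N. (\<Prod>i\<in>S. w i) * det (rank_one_sum N (\<lambda>_. 1) a b S))"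
    using I by (intro sum.cong refl arg_cong2[where f = "(*)"])
      (auto simp: det_rank_one_sum_inj_maps finite_subset)
  finally show ?thesis .
qed

text \<open>
  \<open>N\<close> integer vectors that generate \<open>\<int>\<^sup>N\<close> form a matrix with an integer inverse, hence of determinant
  1 or -1. The determinant in question is the square of this one.
\<close>
lemma det_rank_one_sum_unimodular:
  fixes b :: "'i \<Rightarrow> nat \<Rightarrow> int"
  assumes S: "finite S" "card S = N"
    and span: "\<And>r. r < N \<Longrightarrow> \<exists>c. \<forall>s<N. (\<Sum>i\<in>S. c i * b i s) = of_bool (r = s)"
  shows "det (rank_one_sum N (\<lambda>_. 1) b b S) = 1"
proof -
  obtain f where f: "bij_betw f {0..<N} S"
    using S ex_bij_betw_nat_finite by blast
  obtain c where c: "\<And>r s. r < N \<Longrightarrow> s < N \<Longrightarrow> (\<Sum>i\<in>S. c r i * b i s) = of_bool (r = s)"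
    using span by metis
  define B where "B = mat N N (\<lambda>(j, s). b (f j) s)"
  define C where "C = mat N N (\<lambda>(r, j). c r (f j))"
  have B: "B \<in> carrier_mat N N" and C: "C \<in> carrier_mat N N"
    by (auto simp: B_def C_def)
  have entry: "(\<Sum>j = 0..<N. c r (f j) * b (f j) s) = of_bool (r = s)" if "r < N" "s < N" for r s
    using c[OF that] sum.reindex_bij_betw[OF f, of "\<lambda>i. c r i * b i s"] by simp
  have "C * B = 1\<^sub>m N"
    by (rule eq_matI) (auto simp: B_def C_def scalar_prod_def entry)
  then have "det C * det B = 1"
    using det_mult[OF C B] by simp
  then have "det B * det B = 1"
    by (auto simp: zmult_eq_1_iff)
  moreover have "rank_one_sum N (\<lambda>_. 1) b b S = transpose_mat B * B"
    by (rule eq_matI)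
       (auto simp: rank_one_sum_def B_def scalar_prod_def sum.reindex_bij_betw[OF f, symmetric])
  ultimately show ?thesis
    using B by (simp add: det_mult[of _ N] det_transpose)
qed

text \<open>A nonzero vector orthogonal to all right factors lies in the kernel.\<close>
lemma det_rank_one_sum_singular:
  fixes a b :: "'i \<Rightarrow> nat \<Rightarrow> 'a :: idom"
  assumes S: "finite S" and "r < N" "x r \<noteq> 0"
    and orth: "\<And>i. i \<in> S \<Longrightarrow> (\<Sum>s<N. b i s * x s) = 0"
  shows "det (rank_one_sum N w a b S) = 0"
proof -
  have "(\<Sum>s<N. (\<Sum>i\<in>S. w i * a i r * b i s) * x s) = 0" for r
  proof -
    have "(\<Sum>s<N. (\<Sum>i\<in>S. w i * a i r * b i s) * x s) = (\<Sum>i\<in>S. w i * a i r * (\<Sum>s<N. b i s * x s))"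
      unfolding sum_distrib_left sum_distrib_right by (subst sum.swap) (simp add: mult_ac)
    then show ?thesis using orth by simp
  qed
  then have "rank_one_sum N w a b S *\<^sub>v vec N x = 0\<^sub>v N"
    by (intro eq_vecI) (auto simp: rank_one_sum_def scalar_prod_def lessThan_atLeast0)
  moreover have "vec N x \<noteq> 0\<^sub>v N"
    using assms by (metis index_vec index_zero_vec(1))
  ultimately show ?thesis
    by (subst det_0_iff_vec_prod_zero[OF rank_one_sum_carrier]) (auto intro!: exI[of _ "vec N x"])
qed

section \<open>Paths and cycles in multigraphs\<close>

lemma madjacent_sym: "sym (madjacent G)"
  by (auto simp: sym_def madjacent_def insert_commute)

definition simple_path :: "('v, 'e) multigraph \<Rightarrow> 'v list \<Rightarrow> 'e list \<Rightarrow> bool" where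
  "simple_path G vs es \<longleftrightarrow> length vs = Suc (length es) \<and> distinct vs \<and> set vs \<subseteq> mverts G \<and>
     set es \<subseteq> medges G \<and> (\<forall>i<length es. mends G (es ! i) = {vs ! i, vs ! Suc i})"

text \<open>
  A step from \<open>x\<close> to the start of a simple path either extends it, or \<open>x\<close> already lies on it
  and the part before \<open>x\<close> is cut off.
\<close>
lemma reachable_imp_simple_path:
  assumes "(x, y) \<in> (madjacent G)\<^sup>*" and "y \<in> mverts G"
  shows "\<exists>vs es. simple_path G vs es \<and> hd vs = x \<and> last vs = y"
  using assms(1)
proof (induction rule: converse_rtrancl_induct)
  case base
  show ?case
    using assms(2) by (intro exI[of _ "[y]"] exI[of _ "[]"]) (simp add: simple_path_def)
next
  case (step x z)
  then obtain vs es where p: "simple_path G vs es" "hd vs = z" "last vs = y" by blast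
  obtain e where e: "e \<in> medges G" "mends G e = {x, z}" "x \<in> mverts G"
    using step.hyps by (auto simp: madjacent_def)
  show ?case
  proof (cases "x \<in> set vs")
    case True
    then obtain j where j: "j < length vs" "vs ! j = x" by (auto simp: in_set_conv_nth)
    then have "simple_path G (drop j vs) (drop j es)"
      using p(1) set_drop_subset[of j vs] set_drop_subset[of j es]
      by (auto simp: simple_path_def)
    moreover have "hd (drop j vs) = x" "last (drop j vs) = y"
      using j p(3) by (simp_all add: hd_drop_conv_nth)
    ultimately show ?thesis by blast
  next
    case False
    have "vs \<noteq> []" using p(1) by (auto simp: simple_path_def)
    then have "vs ! 0 = z" using p(2) by (simp add: hd_conv_nth)
    then have "simple_path G (x # vs) (e # es)"
      using p(1) e False by (auto simp: simple_path_def nth_Cons split: nat.splits)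
    then show ?thesis
      using p \<open>vs \<noteq> []\<close> by (intro exI[of _ "x # vs"] exI[of _ "e # es"]) simp
  qed
qed

lemma simple_path_edges_distinct:
  assumes "simple_path G vs es"
  shows "distinct es"
  unfolding distinct_conv_nth
proof (intro allI impI)
  fix i j assume ij: "i < length es" "j < length es" "i \<noteq> j"
  show "es ! i \<noteq> es ! j"
  proof
    assume "es ! i = es ! j"
    then have "{vs ! i, vs ! Suc i} = {vs ! j, vs ! Suc j}"
      using assms ij unfolding simple_path_def by metis
    then show False
      using assms ij by (auto simp: simple_path_def doubleton_eq_iff nth_eq_iff_index_eq)
  qed
qed

lemma simple_path_closes_cycle:
  assumes p: "simple_path G vs es" and e: "e \<in> medges G" "e \<notin> set es" "mends G e = {hd vs, last vs}"
  shows "mcycle G vs (es @ [e])"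
proof -
  have len: "length vs = Suc (length es)" and "vs \<noteq> []"
    using p by (auto simp: simple_path_def)
  then have ends: "hd vs = vs ! 0" "last vs = vs ! length es"
    by (simp_all add: hd_conv_nth last_conv_nth)
  have "mends G ((es @ [e]) ! i) = {vs ! i, vs ! (Suc i mod length vs)}" if "i < length vs" for i
    using that p len e ends by (cases "i = length es") (auto simp: simple_path_def nth_append)
  then show ?thesis
    using p e simple_path_edges_distinct[OF p] \<open>vs \<noteq> []\<close>
    by (auto simp: mcycle_def simple_path_def)
qed

text \<open>The rest of the cycle is a detour around the removed edge.\<close>
lemma mconnected_remove_cycle_edge:
  assumes conn: "mconnected G" and cycle: "mcycle G vs es"
  shows "mconnected (G\<lparr>medges := medges G - {es ! 0}\<rparr>)"
proof -
  let ?H = "G\<lparr>medges := medges G - {es ! 0}\<rparr>"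
  let ?R = "(madjacent ?H)\<^sup>*"
  let ?m = "length vs"
  have m: "?m > 0" "length es = ?m" and vs: "set vs \<subseteq> mverts G" and "distinct es"
    and es: "set es \<subseteq> medges G"
    and ends: "\<And>i. i < ?m \<Longrightarrow> mends G (es ! i) = {vs ! i, vs ! (Suc i mod ?m)}"
    using cycle by (auto simp: mcycle_def)
  have R_sym: "(x, y) \<in> ?R \<Longrightarrow> (y, x) \<in> ?R" for x y
    using madjacent_sym[of ?H] by (meson symD sym_rtrancl)
  have step: "(vs ! i, vs ! (Suc i mod ?m)) \<in> ?R" if "0 < i" "i < ?m" for i
  proof -
    have "es ! i \<in> medges G - {es ! 0}"
      using that m es \<open>distinct es\<close> by (auto simp: nth_eq_iff_index_eq)
    moreover have "vs ! i \<in> mverts G" "vs ! (Suc i mod ?m) \<in> mverts G"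
      using that vs m by auto
    ultimately have "(vs ! i, vs ! (Suc i mod ?m)) \<in> madjacent ?H"
      using ends[OF that(2)] by (auto simp: madjacent_def)
    then show ?thesis by blast
  qed
  \<comment> \<open>The step from index 0 is the removed edge, so the walk starts at index 1 and ends at index 0. For a loop
    both indices are 0.\<close>
  have around: "(vs ! (1 mod ?m), vs ! (Suc i mod ?m)) \<in> ?R" if "i < ?m" for i
    using that
  proof (induction i)
    case (Suc i)
    then show ?case using step[of "Suc i"] by (auto intro: rtrancl_trans)
  qed simp
  have detour: "(vs ! (1 mod ?m), vs ! 0) \<in> ?R"
    using around[of "?m - 1"] m by simp
  have "madjacent G \<subseteq> ?R"
  proof clarify
    fix x y assume "(x, y) \<in> madjacent G"
    then obtain e where e: "e \<in> medges G" "mends G e = {x, y}" "x \<in> mverts G" "y \<in> mverts G"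
      by (auto simp: madjacent_def)
    show "(x, y) \<in> ?R"
    proof (cases "e = es ! 0")
      case True
      then have "{x, y} = {vs ! 0, vs ! (1 mod ?m)}"
        using e ends[of 0] m by simp
      then show ?thesis
        using detour R_sym by (auto simp: doubleton_eq_iff)
    next
      case False
      then have "(x, y) \<in> madjacent ?H" using e by (auto simp: madjacent_def)
      then show ?thesis by blast
    qed
  qed
  then have "(madjacent G)\<^sup>* \<subseteq> ?R"
    using rtrancl_subset_rtrancl by blast
  then show ?thesis
    using conn by (auto simp: mconnected_def)
qed

section \<open>The matrix-tree theorem\<close>

text \<open>
  The orientation, given by \<open>head\<close> and \<open>tail\<close>, only fixes the signs of the incidence vectors, which
  cancel in the Laplacian. A loop has the incidence vector 0.
\<close>
locale oriented_multigraph =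
  fixes G :: "('v, 'e) multigraph" and head tail :: "'e \<Rightarrow> 'v" and idx :: "'v \<Rightarrow> nat" and N :: nat
  assumes finite_edges: "finite (medges G)"
    and incident: "\<And>e. e \<in> medges G \<Longrightarrow>
      head e \<in> mverts G \<and> tail e \<in> mverts G \<and> mends G e = {head e, tail e}"
    and idx: "bij_betw idx (mverts G) {..<N}"
    and N_pos: "N > 0"
begin

abbreviation subgraph :: "'e set \<Rightarrow> ('v, 'e) multigraph" where
  "subgraph T \<equiv> G\<lparr>medges := T\<rparr>"

definition incidence :: "'e \<Rightarrow> nat \<Rightarrow> int" where
  "incidence e s = of_bool (s = idx (head e)) - of_bool (s = idx (tail e))"

text \<open>
  The vectors of the expansion: incidence vectors for the edges, unit vectors for the vertices. To
  choose the unit vector of \<open>v\<close> means to choose \<open>v\<close> as a root.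
\<close>
definition rooted_incidence :: "'e + 'v \<Rightarrow> nat \<Rightarrow> int" where
  "rooted_incidence = case_sum incidence (\<lambda>v s. of_bool (s = idx v))"

abbreviation root_minor :: "('e + 'v) set \<Rightarrow> int" where
  "root_minor S \<equiv> det (rank_one_sum N (\<lambda>_. 1) rooted_incidence rooted_incidence S)"

lemma rooted_incidence_simps [simp]: "rooted_incidence (Inl e) = incidence e" "rooted_incidence (Inr v) s = of_bool (s = idx v)"
  by (simp_all add: rooted_incidence_def)

lemma finite_verts: "finite (mverts G)"
  using idx bij_betw_finite by blast

lemma card_verts: "card (mverts G) = N"
  using bij_betw_same_card[OF idx] by simp

lemma verts_nonempty: "mverts G \<noteq> {}"
  using card_verts N_pos by auto

lemma idx_less: "v \<in> mverts G \<Longrightarrow> idx v < N"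
  using idx by (auto simp: bij_betw_def)

lemma idx_eq_iff: "v \<in> mverts G \<Longrightarrow> w \<in> mverts G \<Longrightarrow> idx v = idx w \<longleftrightarrow> v = w"
  using idx by (auto simp: bij_betw_def inj_on_def)

lemma sum_incidence_mult:
  assumes "e \<in> medges G"
  shows "(\<Sum>s<N. incidence e s * x s) = x (idx (head e)) - x (idx (tail e))"
  using incident[OF assms] idx_less
  by (simp add: incidence_def left_diff_distrib sum_subtractf)

lemma sum_delta_mult:
  assumes "v \<in> mverts G"
  shows "(\<Sum>s<N. rooted_incidence (Inr v) s * x s) = x (idx v)"
  using idx_less[OF assms] by simp

text \<open>Add up the incidence vectors along a path, with signs.\<close>
lemma reachable_imp_incidence_span:
  assumes T: "T \<subseteq> medges G" and "(v, r) \<in> (madjacent (subgraph T))\<^sup>*"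
  shows "\<exists>c. \<forall>s. (\<Sum>e\<in>T. c e * incidence e s) = of_bool (s = idx v) - of_bool (s = idx r)"
  using assms(2)
proof (induction rule: converse_rtrancl_induct)
  case base
  show ?case by (intro exI[of _ "\<lambda>_. 0"]) simp
next
  case (step v w)
  then obtain c where c: "\<And>s. (\<Sum>e\<in>T. c e * incidence e s) = of_bool (s = idx w) - of_bool (s = idx r)"
    by blast
  obtain e where e: "e \<in> T" "mends G e = {v, w}"
    using step.hyps by (auto simp: madjacent_def)
  then have "{v, w} = {head e, tail e}"
    using incident T by auto
  \<comment> \<open>the sign with which the step traverses \<open>e\<close>\<close>
  then obtain a where a: "\<And>s. a * incidence e s = of_bool (s = idx v) - of_bool (s = idx w)"
    by (auto simp: doubleton_eq_iff incidence_def intro: that[of 1] that[of "-1"])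
  have "(\<Sum>f\<in>T. (c f + (if f = e then a else 0)) * incidence f s) =
      of_bool (s = idx v) - of_bool (s = idx r)" for s
  proof -
    have "(\<Sum>f\<in>T. (c f + (if f = e then a else 0)) * incidence f s) =
        (\<Sum>f\<in>T. c f * incidence f s) + (\<Sum>f\<in>T. if f = e then a * incidence e s else 0)"
      by (subst sum.distrib[symmetric]) (intro sum.cong, auto simp: distrib_right)
    then show ?thesis
      using c e T finite_edges by (simp add: finite_subset a)
  qed
  then show ?case by (intro exI allI)
qed

lemma connected_imp_rooted_incidence_span:
  assumes T: "T \<subseteq> medges G" and conn: "mconnected (subgraph T)" and r: "r \<in> mverts G" and "p < N"
  shows "\<exists>c. \<forall>s<N. (\<Sum>i\<in>insert (Inr r) (Inl ` T). c i * rooted_incidence i s) = of_bool (p = s)"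
proof -
  obtain v where v: "v \<in> mverts G" "idx v = p"
    using idx \<open>p < N\<close> by (metis bij_betw_imp_surj_on imageE lessThan_iff)
  have "(v, r) \<in> (madjacent (subgraph T))\<^sup>*"
    using conn v r by (auto simp: mconnected_def)
  then obtain c where c: "\<And>s. (\<Sum>e\<in>T. c e * incidence e s) = of_bool (s = p) - of_bool (s = idx r)"
    using reachable_imp_incidence_span[OF T, of v r] v by blast
  have "finite T" using T finite_edges finite_subset by blast
  then have "(\<Sum>i\<in>insert (Inr r) (Inl ` T). case_sum c (\<lambda>_. 1) i * rooted_incidence i s) = of_bool (p = s)" for s
    by (subst sum.insert) (auto simp: sum.reindex c)
  then show ?thesis by blast
qed

lemma minor_connected:
  assumes T: "T \<subseteq> medges G" "card T = N - 1" and conn: "mconnected (subgraph T)" and r: "r \<in> mverts G"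
  shows "root_minor (insert (Inr r) (Inl ` T)) = 1"
proof (rule det_rank_one_sum_unimodular)
  have "finite T" using T finite_edges finite_subset by blast
  then show "finite (insert (Inr r) (Inl ` T) :: ('e + 'v) set)" by simp
  show "card (insert (Inr r) (Inl ` T) :: ('e + 'v) set) = N"
    using \<open>finite T\<close> T(2) N_pos by (subst card_insert_disjoint) (auto simp: card_image)
qed (rule connected_imp_rooted_incidence_span[OF T(1) conn r])

text \<open>
  The indicator function of the vertices that are not connected to \<open>r\<close> is orthogonal to the
  incidence vectors, since it is constant along each edge, and to the unit vector of \<open>r\<close>.
\<close>
lemma det_rank_one_sum_disconnected:
  assumes T: "T \<subseteq> medges G" and disc: "\<not> mconnected (subgraph T)" and r: "r \<in> mverts G"
  shows "det (rank_one_sum N w a rooted_incidence (insert (Inr r) (Inl ` T))) = 0"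
proof -
  let ?R = "(madjacent (subgraph T))\<^sup>*"
  have R_sym: "(x, y) \<in> ?R \<Longrightarrow> (y, x) \<in> ?R" for x y
    using madjacent_sym[of "subgraph T"] by (meson symD sym_rtrancl)
  obtain u where u: "u \<in> mverts G" "(u, r) \<notin> ?R"
  proof (rule ccontr)
    assume "\<not> thesis"
    then have "\<And>u. u \<in> mverts G \<Longrightarrow> (u, r) \<in> ?R" using that by blast
    then have "mconnected (subgraph T)"
      using R_sym r by (auto simp: mconnected_def intro: rtrancl_trans[of _ r])
    then show False using disc by contradiction
  qed
  define x :: "nat \<Rightarrow> int" where "x s = of_bool (\<exists>v\<in>mverts G. s = idx v \<and> (v, r) \<notin> ?R)" for s
  have x_idx: "x (idx v) = of_bool ((v, r) \<notin> ?R)" if "v \<in> mverts G" for v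
    using that idx_eq_iff by (auto simp: x_def)
  show ?thesis
  proof (rule det_rank_one_sum_singular[where x = x and r = "idx u"])
    show "finite (insert (Inr r) (Inl ` T) :: ('e + 'v) set)"
      using T finite_edges finite_subset by auto
    show "idx u < N" "x (idx u) \<noteq> 0"
      using u by (simp_all add: idx_less x_idx)
    fix i :: "'e + 'v" assume "i \<in> insert (Inr r) (Inl ` T)"
    then consider "i = Inr r" | e where "i = Inl e" "e \<in> T" by blast
    then show "(\<Sum>s<N. rooted_incidence i s * x s) = 0"
    proof cases
      case 1
      then show ?thesis using sum_delta_mult[OF r, of x] x_idx[OF r] by simp
    next
      case 2
      then have e: "e \<in> medges G" using T by blast
      then have "(head e, tail e) \<in> madjacent (subgraph T)" "(tail e, head e) \<in> madjacent (subgraph T)"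
        using incident[OF e] 2 by (auto simp: madjacent_def)
      then have "(head e, r) \<in> ?R \<longleftrightarrow> (tail e, r) \<in> ?R"
        by (meson converse_rtrancl_into_rtrancl)
      then show ?thesis
        using 2 sum_incidence_mult[OF e, of x] incident[OF e] by (simp add: x_idx)
    qed
  qed
qed

text \<open>Incidence vectors are orthogonal to the constant vector.\<close>
lemma det_rank_one_sum_rootless:
  assumes T: "T \<subseteq> medges G"
  shows "det (rank_one_sum N w a rooted_incidence (Inl ` T)) = 0"
proof (rule det_rank_one_sum_singular[where x = "\<lambda>_. 1" and r = 0])
  show "finite (Inl ` T :: ('e + 'v) set)"
    using T finite_edges finite_subset by auto
  show "(\<Sum>s<N. rooted_incidence i s * 1) = 0" if "i \<in> Inl ` T" for i
    using that T sum_incidence_mult[where x = "\<lambda>_. 1"] by auto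
qed (use N_pos in auto)

text \<open>
  A connected edge set has at least \<open>N - 1\<close> edges, and a connected subset with exactly that many. Linear
  algebra replaces the usual induction on the number of components: the vectors of a connected set
  and a root combine to the identity matrix, whose determinant is 1. So some term of its expansion
  is nonzero, and the edges of this term must be connected by the preceding two lemmas.
\<close>
lemma connected_contains_small_connected:
  assumes T: "T \<subseteq> medges G" and conn: "mconnected (subgraph T)"
  shows "\<exists>S\<subseteq>T. card S = N - 1 \<and> mconnected (subgraph S)"
proof -
  obtain r where r: "r \<in> mverts G" using verts_nonempty by blast
  let ?I = "insert (Inr r) (Inl ` T)"
  have fin: "finite T" using T finite_edges finite_subset by blast
  obtain c where c: "\<And>p s. p < N \<Longrightarrow> s < N \<Longrightarrow> (\<Sum>i\<in>?I. c p i * rooted_incidence i s) = of_bool (p = s)"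
    using connected_imp_rooted_incidence_span[OF T conn r] by metis
  \<comment> \<open>The coefficients of the combinations serve as left factors.\<close>
  let ?M = "rank_one_sum N (\<lambda>_. 1) (\<lambda>i p. c p i) rooted_incidence"
  have "?M ?I = 1\<^sub>m N"
    by (rule eq_matI) (auto simp: rank_one_sum_def c simp del: sum.insert)
  then have "det (?M ?I) \<noteq> 0" by simp
  then have "(\<Sum>S | S \<subseteq> ?I \<and> card S = N. det (?M S)) \<noteq> 0"
    using fin by (subst (asm) det_rank_one_sum_expand) auto
  then obtain S where S: "S \<subseteq> ?I" "card S = N" "det (?M S) \<noteq> 0"
    by (metis (mono_tags, lifting) mem_Collect_eq sum.not_neutral_contains_not_neutral)
  define A where "A = Inl -` S"
  have A: "A \<subseteq> T" using S(1) by (auto simp: A_def)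
  have "Inr r \<in> S"
  proof (rule ccontr)
    assume "Inr r \<notin> S"
    then have "S = Inl ` A" using S(1) by (auto simp: A_def)
    then show False using S(3) det_rank_one_sum_rootless A T by auto
  qed
  then have S_eq: "S = insert (Inr r) (Inl ` A)"
    using S(1) by (auto simp: A_def)
  moreover have "finite A" using A fin finite_subset by blast
  ultimately have "card A = N - 1"
    using S(2) by (subst (asm) S_eq, subst (asm) card_insert_disjoint) (auto simp: card_image)
  moreover have "mconnected (subgraph A)"
    using S(3) S_eq det_rank_one_sum_disconnected A T r by (metis subset_trans)
  ultimately show ?thesis using A by blast
qed

text \<open>
  A tree \<open>T\<close> contains a connected set of \<open>N - 1\<close> edges; a further edge of \<open>T\<close> would close a cycle.
  Conversely, if \<open>N - 1\<close> connecting edges contained a cycle, one of them could be removed, which leaves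
  too few edges to connect the graph.
\<close>
lemma spanning_trees_eq:
  "spanning_trees G = {T. T \<subseteq> medges G \<and> card T = N - 1 \<and> mconnected (subgraph T)}"
proof (rule subset_antisym; rule subsetI)
  fix T assume "T \<in> spanning_trees G"
  then have T: "T \<subseteq> medges G" "mconnected (subgraph T)" "\<And>vs es. \<not> mcycle (subgraph T) vs es"
    by (auto simp: spanning_trees_def mtree_def)
  obtain S where S: "S \<subseteq> T" "card S = N - 1" "mconnected (subgraph S)"
    using connected_contains_small_connected[OF T(1,2)] by blast
  have "S = T"
  proof (rule ccontr)
    assume "S \<noteq> T"
    then obtain e where e: "e \<in> T" "e \<notin> S" using S(1) by blast
    then have inc_e: "head e \<in> mverts G" "tail e \<in> mverts G" "mends G e = {head e, tail e}"
      using incident T(1) by auto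
    then have "(head e, tail e) \<in> (madjacent (subgraph S))\<^sup>*"
      using S(3) by (auto simp: mconnected_def)
    then obtain vs es where p: "simple_path (subgraph S) vs es" "hd vs = head e" "last vs = tail e"
      using reachable_imp_simple_path[of "head e" "tail e" "subgraph S"] inc_e by auto
    then have "simple_path (subgraph T) vs es" "e \<notin> set es"
      using S(1) e by (auto simp: simple_path_def)
    then have "mcycle (subgraph T) vs (es @ [e])"
      using e inc_e p by (intro simple_path_closes_cycle) auto
    then show False using T(3) by blast
  qed
  then show "T \<in> {T. T \<subseteq> medges G \<and> card T = N - 1 \<and> mconnected (subgraph T)}"
    using S T by auto
next
  fix T assume "T \<in> {T. T \<subseteq> medges G \<and> card T = N - 1 \<and> mconnected (subgraph T)}"
  then have T: "T \<subseteq> medges G" "card T = N - 1" "mconnected (subgraph T)" by auto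
  have "\<not> mcycle (subgraph T) vs es" for vs es
  proof
    assume cyc: "mcycle (subgraph T) vs es"
    then have "es ! 0 \<in> T" by (auto simp: mcycle_def)
    have "mconnected (subgraph (T - {es ! 0}))"
      using mconnected_remove_cycle_edge[OF T(3) cyc] by simp
    then obtain S where "S \<subseteq> T - {es ! 0}" "card S = N - 1"
      using connected_contains_small_connected[of "T - {es ! 0}"] T(1) by blast
    then show False
      using \<open>es ! 0 \<in> T\<close> T(1,2) finite_edges
      by (metis card_Diff1_less card_mono finite_Diff finite_subset not_less)
  qed
  then show "T \<in> spanning_trees G"
    using T by (auto simp: spanning_trees_def mtree_def)
qed

definition shifted_laplacian :: "complex \<Rightarrow> complex mat" where
  "shifted_laplacian x = mat N N (\<lambda>(r, c).
     of_int (\<Sum>e\<in>medges G. incidence e r * incidence e c) + x * of_bool (r = c))"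

text \<open>
  In the sum, \<open>Inr -` S\<close> is the set of roots chosen by \<open>S\<close>. The minors are taken over the
  integers, where a matrix of determinant 1 or -1 is recognised by its inverse.
\<close>
lemma det_shifted_laplacian:
  "det (shifted_laplacian x) =
    (\<Sum>S | S \<subseteq> medges G <+> mverts G \<and> card S = N. x ^ card (Inr -` S) * of_int (root_minor S))"
proof -
  let ?I = "medges G <+> mverts G"
  let ?col = "\<lambda>i s. of_int (rooted_incidence i s) :: complex"
  have fin: "finite ?I"
    using finite_edges finite_verts by simp
  have root_part: "(\<Sum>v\<in>mverts G. x * of_bool (r = idx v) * of_bool (c = idx v)) = x * of_bool (r = c)"
    if "r < N" for r c
  proof -
    have "(\<Sum>v\<in>mverts G. x * of_bool (r = idx v) * of_bool (c = idx v)) =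
        (\<Sum>s<N. x * of_bool (r = s) * of_bool (c = s))"
      by (rule sum.reindex_bij_betw[OF idx])
    also have "\<dots> = x * of_bool (r = c)"
      using that by (simp add: of_bool_def if_distrib[of "\<lambda>t. _ * t"] cong: if_cong)
    finally show ?thesis .
  qed
  have "shifted_laplacian x = rank_one_sum N (case_sum (\<lambda>_. 1) (\<lambda>_. x)) ?col ?col ?I"
  proof (rule eq_matI)
    fix r c assume "r < dim_row (rank_one_sum N (case_sum (\<lambda>_. 1) (\<lambda>_. x)) ?col ?col ?I)"
      and "c < dim_col (rank_one_sum N (case_sum (\<lambda>_. 1) (\<lambda>_. x)) ?col ?col ?I)"
    then have "r < N" "c < N" by (simp_all add: rank_one_sum_def)
    then show "shifted_laplacian x $$ (r, c) =
        rank_one_sum N (case_sum (\<lambda>_. 1) (\<lambda>_. x)) ?col ?col ?I $$ (r, c)"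
      using root_part[of r c]
      by (simp add: shifted_laplacian_def rank_one_sum_def sum.Plus finite_edges finite_verts mult.assoc)
  qed (simp_all add: shifted_laplacian_def rank_one_sum_def)
  then have "det (shifted_laplacian x) = (\<Sum>S | S \<subseteq> ?I \<and> card S = N.
      (\<Prod>i\<in>S. case_sum (\<lambda>_. 1) (\<lambda>_. x) i) * det (rank_one_sum N (\<lambda>_. 1) ?col ?col S))"
    by (simp add: det_rank_one_sum_expand[OF fin])
  also have "\<dots> = (\<Sum>S | S \<subseteq> ?I \<and> card S = N. x ^ card (Inr -` S) * of_int (root_minor S))"
  proof (intro sum.cong arg_cong2[where f = "(*)"] refl)
    fix S assume "S \<in> {S. S \<subseteq> ?I \<and> card S = N}"
    then have "finite S" using fin finite_subset by blast
    have S_eq: "S = (Inl -` S) <+> (Inr -` S)"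
      by (auto simp: Plus_def image_iff) (metis sumE)
    have "finite (Inl -` S)" "finite (Inr -` S)"
      using \<open>finite S\<close> by (auto intro!: finite_vimageI)
    then show "(\<Prod>i\<in>S. case_sum (\<lambda>_. 1) (\<lambda>_. x) i) = x ^ card (Inr -` S)"
      by (subst S_eq) (simp add: prod.Plus)
    have "rank_one_sum N (\<lambda>_. 1) ?col ?col S = map_mat of_int (rank_one_sum N (\<lambda>_. 1) rooted_incidence rooted_incidence S)"
      by (rule eq_matI) (auto simp: rank_one_sum_def)
    then show "det (rank_one_sum N (\<lambda>_. 1) ?col ?col S) = of_int (root_minor S)"
      by (simp add: of_int_hom.hom_det)
  qed
  finally show ?thesis .
qed

text \<open>The sets \<open>S\<close> with one root correspond to pairs of an edge set and a vertex.\<close>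
lemma sum_one_root_minors:
  "(\<Sum>S | S \<subseteq> medges G <+> mverts G \<and> card S = N \<and> card (Inr -` S) = 1. root_minor S) =
     int (N * card (spanning_trees G))"
proof -
  let ?A = "{T. T \<subseteq> medges G \<and> card T = N - 1} \<times> mverts G"
  have fin_T: "finite {T. T \<subseteq> medges G \<and> card T = N - 1}"
    using finite_edges by simp
  have "(\<Sum>S | S \<subseteq> medges G <+> mverts G \<and> card S = N \<and> card (Inr -` S) = 1. root_minor S) =
      (\<Sum>(T, v)\<in>?A. root_minor (insert (Inr v) (Inl ` T)))"
  proof (rule sum.reindex_bij_witness[where i = "\<lambda>(T, v). insert (Inr v) (Inl ` T)"
        and j = "\<lambda>S. (Inl -` S, the_elem (Inr -` S))"])
    fix S :: "('e + 'v) set"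
    assume "S \<in> {S. S \<subseteq> medges G <+> mverts G \<and> card S = N \<and> card (Inr -` S) = 1}"
    then have S: "S \<subseteq> medges G <+> mverts G" "card S = N" "card (Inr -` S) = 1" by auto
    obtain v where v: "Inr -` S = {v}" using S(3) card_1_singletonE by blast
    have S_eq: "S = insert (Inr v) (Inl ` (Inl -` S))"
    proof (rule subset_antisym)
      show "S \<subseteq> insert (Inr v) (Inl ` (Inl -` S))"
      proof
        fix i assume "i \<in> S"
        then show "i \<in> insert (Inr v) (Inl ` (Inl -` S))" using v by (cases i) auto
      qed
    qed (use v in auto)
    show eq: "(case (Inl -` S, the_elem (Inr -` S)) of (T, v) \<Rightarrow> insert (Inr v) (Inl ` T)) = S"
      using S_eq v by simp
    have "finite (Inl -` S)" using S(1) finite_edges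
      by (auto intro: finite_subset[of _ "medges G"])
    then have "card (insert (Inr v) (Inl ` (Inl -` S)) :: ('e + 'v) set) = Suc (card (Inl -` S))"
      by (subst card_insert_disjoint) (auto simp: card_image simp del: image_vimage_eq)
    then have "card S = Suc (card (Inl -` S))"
      using S_eq by (simp only:)
    then show "(Inl -` S, the_elem (Inr -` S)) \<in> ?A"
      using S(1,2) v by auto
    show "(case (Inl -` S, the_elem (Inr -` S)) of (T, v) \<Rightarrow> root_minor (insert (Inr v) (Inl ` T))) = root_minor S"
      using S_eq v by simp
  next
    fix p assume "p \<in> ?A"
    then obtain T v where p: "p = (T, v)" "T \<subseteq> medges G" "card T = N - 1" "v \<in> mverts G" by auto
    have roots: "Inr -` insert (Inr v) (Inl ` T) = {v}" "Inl -` insert (Inr v) (Inl ` T) = T"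
      by auto
    show "(Inl -` (case p of (T, v) \<Rightarrow> insert (Inr v) (Inl ` T)),
        the_elem (Inr -` (case p of (T, v) \<Rightarrow> insert (Inr v) (Inl ` T)))) = p"
      by (simp add: p roots)
    have "finite T" using p finite_edges finite_subset by blast
    then have "card (insert (Inr v) (Inl ` T) :: ('e + 'v) set) = N"
      using p N_pos by (subst card_insert_disjoint) (auto simp: card_image)
    then show "(case p of (T, v) \<Rightarrow> insert (Inr v) (Inl ` T)) \<in>
        {S. S \<subseteq> medges G <+> mverts G \<and> card S = N \<and> card (Inr -` S) = 1}"
      using p roots by auto
  qed
  also have "\<dots> = (\<Sum>T | T \<subseteq> medges G \<and> card T = N - 1. \<Sum>v\<in>mverts G. root_minor (insert (Inr v) (Inl ` T)))"
    by (rule sum.cartesian_product[symmetric])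
  also have "\<dots> = (\<Sum>T | T \<subseteq> medges G \<and> card T = N - 1. int N * of_bool (mconnected (subgraph T)))"
  proof (intro sum.cong refl)
    fix T assume "T \<in> {T. T \<subseteq> medges G \<and> card T = N - 1}"
    then have "root_minor (insert (Inr v) (Inl ` T)) = of_bool (mconnected (subgraph T))"
      if "v \<in> mverts G" for v
      using that minor_connected det_rank_one_sum_disconnected by auto
    then show "(\<Sum>v\<in>mverts G. root_minor (insert (Inr v) (Inl ` T))) = int N * of_bool (mconnected (subgraph T))"
      by (simp add: card_verts)
  qed
  also have "\<dots> = int N * int (card ({T. T \<subseteq> medges G \<and> card T = N - 1} \<inter> {T. mconnected (subgraph T)}))"
    using fin_T by (simp add: sum_distrib_left[symmetric])
  also have "{T. T \<subseteq> medges G \<and> card T = N - 1} \<inter> {T. mconnected (subgraph T)} = spanning_trees G"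
    by (auto simp: spanning_trees_eq)
  finally show ?thesis by simp
qed

text \<open>
  Kirchhoff's theorem: \<open>N * \<tau>\<close> is the linear coefficient of \<open>det (L + x I)\<close>, whose constant coefficient
  vanishes.
\<close>
theorem matrix_tree:
  "((\<lambda>x. det (shifted_laplacian x) / x) \<longlongrightarrow> of_nat (N * card (spanning_trees G))) (at 0)"
proof -
  let ?\<S> = "{S. S \<subseteq> medges G <+> mverts G \<and> card S = N}"
  let ?k = "\<lambda>S :: ('e + 'v) set. card (Inr -` S :: 'v set)"
  \<comment> \<open>\<open>p\<close> extends \<open>det (L + x I) / x\<close> continuously to \<open>x = 0\<close>; there only the terms with one root survive.\<close>
  define p :: "complex \<Rightarrow> complex" where
    "p x = (\<Sum>S \<in> {S \<in> ?\<S>. ?k S \<noteq> 0}. x ^ (?k S - 1) * of_int (root_minor S))" for x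
  have fin: "finite ?\<S>"
    using finite_edges finite_verts by simp
  have rootless: "root_minor S = 0" if "S \<in> ?\<S>" "?k S = 0" for S
  proof -
    have "finite (Inr -` S :: 'v set)"
      using that finite_verts by (auto intro: finite_subset[of _ "mverts G"])
    then have "Inr -` S = ({} :: 'v set)" using that by simp
    then have "S = Inl ` (Inl -` S)"
      by (auto simp: image_iff) (metis sumE vimageI empty_iff)
    moreover have "Inl -` S \<subseteq> medges G" using that by auto
    ultimately show ?thesis using det_rank_one_sum_rootless by metis
  qed
  have "det (shifted_laplacian x) / x = p x" if "x \<noteq> 0" for x
  proof -
    have "det (shifted_laplacian x) = (\<Sum>S \<in> {S \<in> ?\<S>. ?k S \<noteq> 0}. x ^ ?k S * of_int (root_minor S))"
      unfolding det_shifted_laplacian using fin rootless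
      by (intro sum.mono_neutral_right) auto
    also have "\<dots> = x * p x"
      unfolding p_def sum_distrib_left
      by (intro sum.cong refl) (simp add: power_eq_if)
    finally show ?thesis using that by simp
  qed
  moreover have "(p \<longlongrightarrow> p 0) (at 0)"
    unfolding p_def by (intro tendsto_intros)
  ultimately have "((\<lambda>x. det (shifted_laplacian x) / x) \<longlongrightarrow> p 0) (at 0)"
    by (subst tendsto_cong[of _ p]) (simp_all add: eventually_at_filter)
  moreover have "p 0 = (\<Sum>S | S \<subseteq> medges G <+> mverts G \<and> card S = N \<and> ?k S = 1. of_int (root_minor S))"
    unfolding p_def
    by (intro sum.mono_neutral_cong_right finite_subset[OF _ fin]) (auto simp: power_0_left)
  moreover have "\<dots> = of_int (int (N * card (spanning_trees G)))"
    by (simp only: of_int_sum[symmetric] sum_one_root_minors)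
  ultimately show ?thesis by simp
qed

end

section \<open>Circulant matrices and the discrete Fourier transform\<close>

definition unity_root :: "nat \<Rightarrow> nat \<Rightarrow> complex" where
  "unity_root n j = cis (2 * pi * real j / real n)"

lemma unity_root_bij: "n > 0 \<Longrightarrow> bij_betw (unity_root n) {..<n} {z. z ^ n = 1}"
  using Complex.bij_betw_roots_unity[of n] by (simp add: unity_root_def[abs_def])

lemma unity_root_power: "n > 0 \<Longrightarrow> j < n \<Longrightarrow> unity_root n j ^ n = 1"
  using unity_root_bij[of n] by (auto simp: bij_betw_def)

lemma norm_unity_root [simp]: "norm (unity_root n j) = 1"
  by (simp add: unity_root_def)

lemma power_mod_eq:
  assumes "(w :: 'a :: monoid_mult) ^ n = 1"
  shows "w ^ (a mod n) = w ^ a"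
proof -
  have "w ^ a = w ^ (n * (a div n) + a mod n)" by simp
  also have "\<dots> = w ^ (a mod n)"
    using assms by (simp only: power_add power_mult) simp
  finally show ?thesis ..
qed

lemma shift_mod_bij:
  fixes n m :: nat
  assumes "n > 0"
  shows "bij_betw (\<lambda>i. (i + m) mod n) {..<n} {..<n}"
proof -
  have "i = j" if "i < n" "j \<le> i" "(i + m) mod n = (j + m) mod n" for i j
  proof -
    have "n dvd (i + m) - (j + m)"
      using that by (subst mod_eq_dvd_iff_nat[symmetric]) auto
    then show ?thesis
      using that by (auto dest: dvd_imp_le)
  qed
  then have "inj_on (\<lambda>i. (i + m) mod n) {..<n}"
    by (intro inj_onI) (metis lessThan_iff nle_le)
  moreover have "(\<lambda>i. (i + m) mod n) ` {..<n} \<subseteq> {..<n}" using assms by auto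
  ultimately show ?thesis
    by (simp add: bij_betw_def endo_inj_surj)
qed

text \<open>
  The operator \<open>3 + x - T ^ m - inverse T ^ m\<close> for the cyclic shift \<open>T\<close>. If \<open>m\<close> is a multiple of \<open>n\<close>
  or of \<open>n / 2\<close>, some of the indicators coincide, and the loops and double edges of the I-graph are
  accounted for.
\<close>
definition circulant_block :: "nat \<Rightarrow> nat \<Rightarrow> complex \<Rightarrow> complex mat" where
  "circulant_block n m x = mat n n (\<lambda>(r, c). (3 + x) * of_bool (r = c)
     - of_bool (c = (r + m) mod n) - of_bool (r = (c + m) mod n))"

text \<open>The eigenvalue of \<open>circulant_block n m x\<close> at the eigenvector \<open>(1, w, w\<^sup>2, \<dots>)\<close>, for \<open>w ^ n = 1\<close>.\<close>
definition symbol :: "nat \<Rightarrow> complex \<Rightarrow> complex \<Rightarrow> complex" where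
  "symbol m x w = 3 + x - w ^ m - w powi (- int m)"

definition fourier :: "nat \<Rightarrow> complex mat" where
  "fourier n = mat n n (\<lambda>(r, j). unity_root n j ^ r)"

lemma circulant_block_carrier [simp]: "circulant_block n m x \<in> carrier_mat n n"
  by (simp add: circulant_block_def)

lemma fourier_carrier [simp]: "fourier n \<in> carrier_mat n n"
  by (simp add: fourier_def)

lemma circulant_block_eigenvector:
  assumes n: "n > 0" and w: "w ^ n = 1" and r: "r < n"
  shows "(\<Sum>c<n. ((3 + x) * of_bool (r = c) - of_bool (c = (r + m) mod n)
            - of_bool (r = (c + m) mod n)) * w ^ c) = symbol m x w * w ^ r"
proof -
  have w0: "w \<noteq> 0" using w n by (metis power_0_left zero_neq_one less_numeral_extra(3))
  have "(\<Sum>c<n. of_bool (r = (c + m) mod n) * w ^ ((c + m) mod n)) = (\<Sum>c<n. of_bool (r = c) * w ^ c)"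
    by (rule sum.reindex_bij_betw[OF shift_mod_bij[OF n]])
  also have "\<dots> = w ^ r" using r by simp
  finally have "(\<Sum>c<n. of_bool (r = (c + m) mod n) * w ^ c) * w ^ m = w ^ r"
    by (simp add: power_mod_eq[OF w] sum_distrib_left sum_distrib_right power_add mult_ac
        del: sum_of_bool_mult_eq sum_mult_of_bool_eq)
  then have "(\<Sum>c<n. of_bool (r = (c + m) mod n) * w ^ c) = w powi (- int m) * w ^ r"
    using w0 by (simp add: power_int_minus field_simps)
  moreover have "(\<Sum>c<n. of_bool (c = (r + m) mod n) * w ^ c) = w ^ m * w ^ r"
    using n by (simp add: power_mod_eq[OF w] power_add mult_ac)
  moreover have "(\<Sum>c<n. (3 + x) * of_bool (r = c) * w ^ c) = (3 + x) * w ^ r"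
    using r by (simp add: mult.assoc flip: sum_distrib_left)
  ultimately show ?thesis
    by (simp add: left_diff_distrib sum_subtractf symbol_def)
qed

lemma circulant_block_fourier:
  assumes n: "n > 0"
  shows "circulant_block n m x * fourier n = fourier n * mat_diag n (\<lambda>j. symbol m x (unity_root n j))"
proof (rule eq_matI)
  fix r j assume "r < dim_row (fourier n * mat_diag n (\<lambda>j. symbol m x (unity_root n j)))"
    and "j < dim_col (fourier n * mat_diag n (\<lambda>j. symbol m x (unity_root n j)))"
  then have r: "r < n" and j: "j < n"
    by (simp_all add: fourier_def mat_diag_def)
  have "(circulant_block n m x * fourier n) $$ (r, j) = (\<Sum>c<n. ((3 + x) * of_bool (r = c) - of_bool (c = (r + m) mod n)
            - of_bool (r = (c + m) mod n)) * unity_root n j ^ c)"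
    using r j by (simp add: circulant_block_def fourier_def scalar_prod_def lessThan_atLeast0)
  also have "\<dots> = symbol m x (unity_root n j) * unity_root n j ^ r"
    by (rule circulant_block_eigenvector[OF n unity_root_power[OF n j] r])
  finally show "(circulant_block n m x * fourier n) $$ (r, j) =
      (fourier n * mat_diag n (\<lambda>j. symbol m x (unity_root n j))) $$ (r, j)"
    using r j by (simp add: mat_diag_mult_right[OF fourier_carrier]) (simp add: fourier_def)
qed (simp_all add: circulant_block_def fourier_def mat_diag_def)

text \<open>The columns of the Fourier matrix are orthogonal.\<close>
lemma det_fourier_nonzero:
  assumes n: "n > 0"
  shows "det (fourier n) \<noteq> 0"
proof -
  define C where "C = mat n n (\<lambda>(i, s). cnj (unity_root n i) ^ s)"
  have C: "C \<in> carrier_mat n n" by (simp add: C_def)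
  have orth: "(\<Sum>s<n. cnj (unity_root n i) ^ s * unity_root n j ^ s) = of_nat n * of_bool (i = j)"
    if "i < n" "j < n" for i j
  proof -
    let ?z = "cnj (unity_root n i) * unity_root n j"
    have unit: "cnj (unity_root n i) * unity_root n i = 1"
      by (metis complex_norm_square mult.commute norm_unity_root of_real_1 power_one)
    have sum: "(\<Sum>s<n. cnj (unity_root n i) ^ s * unity_root n j ^ s) = (\<Sum>s<n. ?z ^ s)"
      by (simp add: power_mult_distrib)
    show ?thesis
    proof (cases "i = j")
      case True
      then show ?thesis using sum unit by simp
    next
      case False
      have "?z ^ n = 1"
        using that n unity_root_power[of n] by (simp add: power_mult_distrib flip: complex_cnj_power)
      moreover have "?z \<noteq> 1"
      proof
        assume "?z = 1"
        then have "unity_root n i = unity_root n j"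
          using unit by (metis mult.assoc mult.commute mult.right_neutral)
        then show False
          using False that unity_root_bij[OF n] by (auto simp: bij_betw_def inj_on_def)
      qed
      ultimately show ?thesis
        using sum False by (simp add: geometric_sum)
    qed
  qed
  have "C * fourier n = of_nat n \<cdot>\<^sub>m 1\<^sub>m n"
    by (rule eq_matI) (auto simp: C_def fourier_def scalar_prod_def orth simp flip: lessThan_atLeast0)
  then have "det C * det (fourier n) = of_nat n ^ n"
    using det_mult[OF C fourier_carrier] by simp
  then show ?thesis using n by auto
qed

lemma det_mat_diag: "det (mat_diag n f :: 'a :: idom mat) = (\<Prod>j<n. f j)"
  by (subst det_upper_triangular[of _ n])
     (auto simp: prod_list_diag_prod mat_diag_def lessThan_atLeast0 intro!: prod.cong)

text \<open>
  Since the lower blocks commute, the determinant is that of \<open>A D - I\<close>, and the columns of the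
  Fourier matrix are common eigenvectors of \<open>A\<close> and \<open>D\<close>.
\<close>
lemma det_circulant_blocks:
  assumes n: "n > 0"
  shows "det (four_block_mat (circulant_block n l x) (- 1\<^sub>m n) (- 1\<^sub>m n) (circulant_block n k x)) =
    (\<Prod>j<n. symbol l x (unity_root n j) * symbol k x (unity_root n j) - 1)"
proof -
  let ?A = "circulant_block n l x" and ?D = "circulant_block n k x" and ?F = "fourier n"
  let ?a = "\<lambda>j. symbol l x (unity_root n j)" and ?d = "\<lambda>j. symbol k x (unity_root n j)"
  have neg: "(- 1\<^sub>m n) * (- 1\<^sub>m n) = (1\<^sub>m n :: complex mat)"
    by simp
  have comm: "- 1\<^sub>m n * ?D = ?D * - 1\<^sub>m n"
    by (simp add: circulant_block_def)
  have "(?A * ?D) * ?F = ?A * (?F * mat_diag n ?d)"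
    by (simp add: assoc_mult_mat[of _ n n _ n _ n] circulant_block_fourier[OF n])
  also have "\<dots> = (?A * ?F) * mat_diag n ?d"
    by (simp add: assoc_mult_mat[of _ n n _ n _ n])
  also have "\<dots> = ?F * mat_diag n (\<lambda>j. ?a j * ?d j)"
    by (simp add: circulant_block_fourier[OF n] assoc_mult_mat[of _ n n _ n _ n])
  finally have "(?A * ?D - 1\<^sub>m n) * ?F = ?F * mat_diag n (\<lambda>j. ?a j * ?d j) - ?F"
    by (simp add: minus_mult_distrib_mat[OF mult_carrier_mat[OF circulant_block_carrier circulant_block_carrier] _ fourier_carrier]
        left_mult_one_mat[OF fourier_carrier])
  also have "\<dots> = ?F * mat_diag n (\<lambda>j. ?a j * ?d j - 1)"
    unfolding mat_diag_mult_right[OF fourier_carrier]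
    by (rule eq_matI) (auto simp: fourier_def algebra_simps)
  finally have "det ((?A * ?D - 1\<^sub>m n) * ?F) = det (?F * mat_diag n (\<lambda>j. ?a j * ?d j - 1))"
    by (rule arg_cong)
  then have "det (?A * ?D - 1\<^sub>m n) * det ?F = det ?F * (\<Prod>j<n. ?a j * ?d j - 1)"
    unfolding det_mult[OF minus_carrier_mat[OF one_carrier_mat] fourier_carrier]
      det_mult[OF fourier_carrier mat_diag_dim] det_mat_diag .
  then have "det (?A * ?D - 1\<^sub>m n) = (\<Prod>j<n. ?a j * ?d j - 1)"
    using det_fourier_nonzero[OF n] by simp
  then show ?thesis
    by (subst det_four_block_mat[of _ n]) (simp_all add: neg comm)
qed

section \<open>The Laplacian of an I-graph\<close>

primrec ihead :: "iedge \<Rightarrow> ivertex" where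
  "ihead (EU i) = Uvert i"
| "ihead (ES i) = Uvert i"
| "ihead (EV i) = Vvert i"

primrec itail :: "nat \<Rightarrow> nat \<Rightarrow> nat \<Rightarrow> iedge \<Rightarrow> ivertex" where
  "itail n k l (EU i) = Uvert ((i + l) mod n)"
| "itail n k l (ES i) = Vvert i"
| "itail n k l (EV i) = Vvert ((i + k) mod n)"

primrec iidx :: "nat \<Rightarrow> ivertex \<Rightarrow> nat" where
  "iidx n (Uvert i) = i"
| "iidx n (Vvert i) = n + i"

lemma iidx_bij: "bij_betw (iidx n) (Uvert ` {..<n} \<union> Vvert ` {..<n}) {..<2 * n}"
proof (rule bij_betw_imageI)
  show "inj_on (iidx n) (Uvert ` {..<n} \<union> Vvert ` {..<n})"
    by (auto simp: inj_on_def)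
  have "s \<in> iidx n ` (Uvert ` {..<n} \<union> Vvert ` {..<n})" if "s < 2 * n" for s
  proof (cases "s < n")
    case True
    then show ?thesis by (intro image_eqI[of _ _ "Uvert s"]) auto
  next
    case False
    then show ?thesis using that by (intro image_eqI[of _ _ "Vvert (s - n)"]) auto
  qed
  then show "iidx n ` (Uvert ` {..<n} \<union> Vvert ` {..<n}) = {..<2 * n}"
    by auto
qed

lemma I_graph_oriented:
  assumes "n > 0"
  shows "oriented_multigraph (I_graph n k l) ihead (itail n k l) (iidx n) (2 * n)"
proof
  show "bij_betw (iidx n) (mverts (I_graph n k l)) {..<2 * n}"
    using iidx_bij by (simp add: I_graph_def)
qed (use assms in \<open>auto simp: I_graph_def\<close>)

text \<open>The Laplacian entries that come from one of the two families of edges joining \<open>i\<close> to \<open>i + m\<close>.\<close>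
lemma sum_cyclic_edges:
  fixes n m :: nat
  assumes n: "n > 0" and "r < n" "c < n"
  shows "(\<Sum>i<n. (of_bool (r = i) - of_bool (r = (i + m) mod n)) *
            (of_bool (c = i) - of_bool (c = (i + m) mod n))) =
         (2 * of_bool (r = c) - of_bool (c = (r + m) mod n) - of_bool (r = (c + m) mod n) :: int)"
proof -
  have "(\<Sum>i<n. of_bool (r = (i + m) mod n) * of_bool (c = (i + m) mod n)) =
      (\<Sum>i<n. of_bool (r = i) * of_bool (c = i) :: int)"
    by (rule sum.reindex_bij_betw[OF shift_mod_bij[OF n]])
  moreover have "(\<Sum>i<n. of_bool (r = i) * of_bool (c = i)) = (of_bool (r = c) :: int)"
    using assms by simp
  moreover have "(\<Sum>i<n. of_bool (r = i) * of_bool (c = (i + m) mod n)) = (of_bool (c = (r + m) mod n) :: int)"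
    using assms by simp
  moreover have "(\<Sum>i<n. of_bool (r = (i + m) mod n) * of_bool (c = i)) = (of_bool (r = (c + m) mod n) :: int)"
    using assms by simp
  ultimately show ?thesis
    by (simp only: left_diff_distrib right_diff_distrib sum_subtractf)
qed

text \<open>The diagonal blocks belong to the \<open>u\<close>- and the \<open>v\<close>-vertices; the edges \<open>u\<^sub>i v\<^sub>i\<close> yield the other two.\<close>
lemma I_graph_laplacian:
  assumes n: "n > 0"
  shows "oriented_multigraph.shifted_laplacian (I_graph n k l) ihead (itail n k l) (iidx n) (2 * n) x =
    four_block_mat (circulant_block n l x) (- 1\<^sub>m n) (- 1\<^sub>m n) (circulant_block n k x)"
    (is "?L = ?B")
proof -
  interpret oriented_multigraph "I_graph n k l" ihead "itail n k l" "iidx n" "2 * n"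
    by (rule I_graph_oriented[OF n])
  have edges: "(\<Sum>e\<in>medges (I_graph n k l). incidence e r * incidence e c) =
      (\<Sum>i<n. incidence (EU i) r * incidence (EU i) c) + (\<Sum>i<n. incidence (ES i) r * incidence (ES i) c)
      + (\<Sum>i<n. incidence (EV i) r * incidence (EV i) c)" for r c
  proof -
    have "(\<Sum>e\<in>EU ` {..<n} \<union> ES ` {..<n} \<union> EV ` {..<n}. incidence e r * incidence e c) =
      (\<Sum>e\<in>EU ` {..<n}. incidence e r * incidence e c) + (\<Sum>e\<in>ES ` {..<n}. incidence e r * incidence e c)
      + (\<Sum>e\<in>EV ` {..<n}. incidence e r * incidence e c)"
      by (subst sum.union_disjoint; (subst sum.union_disjoint)?) auto
    then show ?thesis
      by (simp add: I_graph_def sum.reindex inj_on_def)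
  qed
  show ?thesis
  proof (rule eq_matI)
    fix r c assume "r < dim_row ?B" "c < dim_col ?B"
    then have rc: "r < 2 * n" "c < 2 * n" by (simp_all add: circulant_block_def)
    have diag: "(\<Sum>i<n. of_bool (a = i) * of_bool (b = i)) = (of_bool (a = b) :: int)"
      if "a < n" for a b :: nat
      using that by simp
    have L: "?L $$ (r, c) =
        of_int (\<Sum>e\<in>medges (I_graph n k l). incidence e r * incidence e c) + x * of_bool (r = c)"
      using rc by (simp add: shifted_laplacian_def)
    have lower: "s \<noteq> (i + m) mod n" if "\<not> s < n" for s i m
      using that n by auto
    have upper: "s \<noteq> n + i" if "s < n" for s i :: nat
      using that by auto
    have sub: "s = n + i \<longleftrightarrow> s - n = i" if "\<not> s < n" for s i
      using that by auto
    consider "r < n" "c < n" | "r < n" "\<not> c < n" | "\<not> r < n" "c < n" | "\<not> r < n" "\<not> c < n" by blast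
    then show "?L $$ (r, c) = ?B $$ (r, c)"
    proof cases
      case 1
      have "(\<Sum>e\<in>medges (I_graph n k l). incidence e r * incidence e c) = 
        (2 * of_bool (r = c) - of_bool (c = (r + l) mod n) - of_bool (r = (c + l) mod n)) + of_bool (r = c)"
        unfolding edges unfolding sum_cyclic_edges[OF n 1, symmetric] incidence_def
        using 1 by (simp add: upper)
      then show ?thesis
        unfolding L using 1 rc by (simp add: circulant_block_def distrib_right)
    next
      case 2
      have "(\<Sum>e\<in>medges (I_graph n k l). incidence e r * incidence e c) = - of_bool (r = c - n)"
        unfolding edges unfolding incidence_def diag[OF \<open>r < n\<close>, of "c - n", symmetric] sum_negf[symmetric]
        using 2 rc by (simp add: upper lower sub mult.commute
            del: sum_of_bool_mult_eq sum_mult_of_bool_eq)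
      then show ?thesis
        unfolding L using 2 rc by (auto simp: circulant_block_def)
    next
      case 3
      have "(\<Sum>e\<in>medges (I_graph n k l). incidence e r * incidence e c) = - of_bool (c = r - n)"
        unfolding edges unfolding incidence_def diag[OF \<open>c < n\<close>, of "r - n", symmetric] sum_negf[symmetric]
        using 3 rc by (simp add: upper lower sub mult.commute
            del: sum_of_bool_mult_eq sum_mult_of_bool_eq)
      then show ?thesis
        unfolding L using 3 rc by (auto simp: circulant_block_def)
    next
      case 4
      have "r - n < n" "c - n < n" using 4 rc by auto
      have "(\<Sum>e\<in>medges (I_graph n k l). incidence e r * incidence e c) = 
        (2 * of_bool (r - n = c - n) - of_bool (c - n = (r - n + k) mod n) - of_bool (r - n = (c - n + k) mod n))
          + of_bool (r - n = c - n)"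
        unfolding edges unfolding sum_cyclic_edges[OF n \<open>r - n < n\<close> \<open>c - n < n\<close>, symmetric] incidence_def
        using 4 rc by (simp add: lower sub)
      moreover have "r = c \<longleftrightarrow> r - n = c - n" using 4 by auto
      ultimately show ?thesis
        unfolding L using 4 rc by (simp add: circulant_block_def distrib_right)
    qed
  qed (simp_all add: shifted_laplacian_def circulant_block_def)
qed

lemma tendsto_symbol: "((\<lambda>x. symbol m x w) \<longlongrightarrow> symbol m a w) (at a)"
  unfolding symbol_def by (intro tendsto_diff tendsto_add tendsto_const tendsto_ident_at)

text \<open>
  The factor for the root of unity 1 is \<open>(1 + x)\<^sup>2 - 1 = x * (2 + x)\<close>. Divided by \<open>x\<close> it tends to 2, which
  cancels against the number \<open>2 * n\<close> of vertices.
\<close>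
theorem tau_eq_prod:
  assumes n: "n > 0"
  shows "of_nat (n * tau k l n) = (\<Prod>j\<in>{0<..<n}. P_laurent k l (unity_root n j))"
proof -
  interpret oriented_multigraph "I_graph n k l" ihead "itail n k l" "iidx n" "2 * n"
    by (rule I_graph_oriented[OF n])
  define g where "g x = (\<Prod>j\<in>{0<..<n}. symbol l x (unity_root n j) * symbol k x (unity_root n j) - 1)"
    for x
  have "det (shifted_laplacian x) / x = (2 + x) * g x" if "x \<noteq> 0" for x
  proof -
    have "{..<n} = insert 0 {0<..<n}" using n by auto
    moreover have "symbol m x (unity_root n 0) = 1 + x" for m
      by (simp add: symbol_def unity_root_def)
    ultimately have "det (shifted_laplacian x) = ((1 + x) * (1 + x) - 1) * g x"
      unfolding I_graph_laplacian[OF n] det_circulant_blocks[OF n] g_def by simp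
    then show ?thesis using that by (simp add: field_simps)
  qed
  moreover have "((\<lambda>x. (2 + x) * g x) \<longlongrightarrow> (2 + 0) * g 0) (at 0)"
    unfolding g_def by (intro tendsto_mult tendsto_add tendsto_const tendsto_ident_at tendsto_prod
        tendsto_diff tendsto_symbol)
  ultimately have "((\<lambda>x. det (shifted_laplacian x) / x) \<longlongrightarrow> (2 + 0) * g 0) (at 0)"
    by (subst tendsto_cong[of _ "\<lambda>x. (2 + x) * g x"]) (simp_all add: eventually_at_filter)
  from tendsto_unique[OF _ matrix_tree this]
  have "of_nat (n * tau k l n) = g 0"
    by (simp add: tau_def)
  also have "\<dots> = (\<Prod>j\<in>{0<..<n}. P_laurent k l (unity_root n j))"
    unfolding g_def by (intro prod.cong refl) (simp add: symbol_def P_laurent_def mult.commute)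
  finally show ?thesis .
qed

section \<open>The roots of the Laurent polynomial\<close>

text \<open>
  Written as \<open>(z ^ n - 1) / (z - 1)\<close>, this would be undefined at \<open>z = 1\<close>. As a polynomial it handles the
  double root 1 of \<open>P\<close> on the same footing as the other roots.
\<close>
definition geo_poly :: "nat \<Rightarrow> complex poly" where
  "geo_poly n = (\<Sum>i<n. monom 1 i)"

lemma poly_geo: "poly (geo_poly n) z = (\<Sum>i<n. z ^ i)"
  by (simp add: geo_poly_def poly_sum poly_monom)

lemma poly_geo_1: "poly (geo_poly n) 1 = of_nat n"
  by (simp add: poly_geo)

lemma mult_poly_geo: "(z - 1) * poly (geo_poly n) z = z ^ n - 1"
  by (simp add: poly_geo power_diff_1_eq)

lemma linear_mult_geo: "[:-1, 1:] * geo_poly n = monom 1 n - 1"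
proof (rule poly_ext)
  show "poly ([:-1, 1:] * geo_poly n) z = poly (monom 1 n - 1) z" for z
    using mult_poly_geo[of z n] by (simp add: poly_monom algebra_simps)
qed

lemma geo_monic:
  assumes "n > 0"
  shows "lead_coeff (geo_poly n) = 1" "degree (geo_poly n) = n - 1"
proof -
  have "lead_coeff (geo_poly (Suc m)) = 1 \<and> degree (geo_poly (Suc m)) = m" for m
  proof (induction m)
    case 0
    show ?case by (simp add: geo_poly_def)
  next
    case (Suc m)
    have "geo_poly (Suc (Suc m)) = geo_poly (Suc m) + monom 1 (Suc m)"
      by (simp add: geo_poly_def)
    then show ?case
      using Suc by (simp add: degree_add_eq_right coeff_eq_0 degree_monom_eq)
  qed
  then show "lead_coeff (geo_poly n) = 1" "degree (geo_poly n) = n - 1"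
    using assms by (metis Suc_pred')+
qed

text \<open>Divide the factorisation of \<open>z ^ n - 1\<close> by \<open>z - 1\<close>; as an identity of polynomials it extends to \<open>z = 1\<close>.\<close>
lemma prod_unity_roots:
  assumes n: "n > 0"
  shows "(\<Prod>j\<in>{0<..<n}. z - unity_root n j) = poly (geo_poly n) z"
proof -
  let ?p = "monom 1 n - 1 :: complex poly"
  have lead: "lead_coeff ?p = 1"
    using n lead_coeff_add_le[of "-1" "monom 1 n :: complex poly"]
    by (simp add: degree_monom_eq)
  have root_iff: "poly ?p w = 0 \<longleftrightarrow> w ^ n = 1" for w
    by (simp add: poly_monom)
  have "rsquarefree ?p"
    unfolding rsquarefree_roots root_iff using n
    by (auto simp: pderiv_diff pderiv_monom poly_monom power_0_left pderiv_1)
  then have "?p = (\<Prod>w | w ^ n = 1. [:-w, 1:])"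
    using complex_poly_decompose_rsquarefree[of ?p] unfolding lead root_iff by simp
  also have "\<dots> = (\<Prod>j<n. [:- unity_root n j, 1:])"
    by (rule prod.reindex_bij_betw[OF unity_root_bij[OF n], symmetric])
  also have "{..<n} = insert 0 {0<..<n}" using n by auto
  also have "(\<Prod>j\<in>insert 0 {0<..<n}. [:- unity_root n j, 1:]) =
      [:-1, 1:] * (\<Prod>j\<in>{0<..<n}. [:- unity_root n j, 1:])"
    by (simp add: unity_root_def)
  finally have "[:-1, 1:] * geo_poly n = [:-1, 1:] * (\<Prod>j\<in>{0<..<n}. [:- unity_root n j, 1:])"
    by (simp only: linear_mult_geo)
  then have "geo_poly n = (\<Prod>j\<in>{0<..<n}. [:- unity_root n j, 1:])"
    by (subst (asm) mult_cancel_left) simp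
  then show ?thesis by (simp add: poly_prod)
qed

text \<open>
  The polynomial \<open>R\<close> with \<open>z ^ (k + l) * P(z) = (z - 1)\<^sup>2 * R(z)\<close>. Its shape comes from
  \<open>3 - a - 1 / a = 1 - (a - 1)\<^sup>2 / a\<close> with \<open>a = z ^ k\<close>, where \<open>a - 1\<close> is \<open>z - 1\<close> times a geometric sum, and
  likewise for \<open>l\<close>. In the resulting expression the factor \<open>(z - 1)\<^sup>2\<close> is visible.
\<close>
definition cofactor :: "nat \<Rightarrow> nat \<Rightarrow> complex poly" where
  "cofactor k l = ([:-1, 1:] * geo_poly k * geo_poly l)\<^sup>2 - monom 1 l * (geo_poly k)\<^sup>2 - monom 1 k * (geo_poly l)\<^sup>2"

lemma P_laurent_cofactor:
  assumes "z \<noteq> 0"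
  shows "z ^ (k + l) * P_laurent k l z = (z - 1)\<^sup>2 * poly (cofactor k l) z"
proof -
  define a b where "a = z ^ k" and "b = z ^ l"
  have nz: "a \<noteq> 0" "b \<noteq> 0" using assms by (simp_all add: a_def b_def)
  have "a * b * ((3 - a - 1 / a) * (3 - b - 1 / b) - 1) = (a - (a - 1)\<^sup>2) * (b - (b - 1)\<^sup>2) - a * b"
    using nz by (simp add: field_simps power2_eq_square)
  also have "\<dots> = ((a - 1) * (b - 1))\<^sup>2 - b * (a - 1)\<^sup>2 - a * (b - 1)\<^sup>2"
    by (simp add: power2_eq_square algebra_simps)
  also have "a - 1 = (z - 1) * poly (geo_poly k) z"
    by (simp add: a_def mult_poly_geo)
  also have "b - 1 = (z - 1) * poly (geo_poly l) z"
    by (simp add: b_def mult_poly_geo)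
  finally show ?thesis
    by (simp add: P_laurent_def cofactor_def power_int_minus power_add poly_monom
        flip: a_def b_def) (simp add: inverse_eq_divide power2_eq_square algebra_simps)
qed

lemma poly_cofactor_1: "poly (cofactor k l) 1 = - of_nat (k\<^sup>2 + l\<^sup>2)"
  by (simp add: cofactor_def poly_monom poly_geo_1)

text \<open>The square dominates: its degree is \<open>2 * (k + l - 1)\<close>, and the degrees of the other terms are lower by \<open>l\<close> and \<open>k\<close>.\<close>
lemma lead_coeff_cofactor:
  assumes "k > 0" "l > 0"
  shows "lead_coeff (cofactor k l) = 1"
proof -
  let ?M = "([:-1, 1:] * geo_poly k * geo_poly l)\<^sup>2"
  have nz: "geo_poly m \<noteq> 0" if "m > 0" for m
    using geo_monic[OF that] by auto
  have deg_lin: "degree ([:-1, 1:] * geo_poly k * geo_poly l) = 1 + (k - 1) + (l - 1)"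
    using assms nz by (simp add: degree_mult_eq geo_monic del: mult_pCons_left)
  have lead_M: "lead_coeff ?M = 1"
    by (simp only: lead_coeff_power lead_coeff_mult geo_monic(1)[OF assms(1)] geo_monic(1)[OF assms(2)]) simp
  have deg_M: "degree ?M = 2 * (k + l - 1)"
    using assms deg_lin by (simp add: degree_power_eq nz del: mult_pCons_left)
  have deg_small: "degree (monom 1 i * (geo_poly j)\<^sup>2) < degree ?M" if "i > 0" "j > 0" "i + j = k + l" for i j
    using that deg_M nz by (simp add: degree_mult_eq degree_monom_eq degree_power_eq geo_monic)
  have "degree (- (monom 1 l * (geo_poly k)\<^sup>2) - monom 1 k * (geo_poly l)\<^sup>2) < degree ?M"
    using deg_small[of l k] deg_small[of k l] assms by (intro degree_diff_less) auto
  from lead_coeff_add_le[OF this] show ?thesis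
    using lead_M by (simp add: cofactor_def algebra_simps del: mult_pCons_left)
qed

lemma cofactor_root_nonzero:
  assumes "k > 0" "l > 0" "poly (cofactor k l) z = 0"
  shows "z \<noteq> 0"
proof
  assume "z = 0"
  moreover have "poly (geo_poly m) 0 = 1" if "m > 0" for m
    using mult_poly_geo[of 0 m] that by (simp add: power_0_left)
  ultimately show False
    using assms by (simp add: cofactor_def poly_monom power_0_left)
qed

text \<open>
  On the unit circle \<open>P = (1 + a) * (1 + b) - 1\<close> with \<open>a = 2 - 2 * Re (z ^ k) \<ge> 0\<close> and
  \<open>b = 2 - 2 * Re (z ^ l) \<ge> 0\<close>. So at a root \<open>a = b = 0\<close>, that is \<open>z ^ k = z ^ l = 1\<close>, and \<open>z = 1\<close> as \<open>k\<close> and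
  \<open>l\<close> are coprime. But 1 is not a root of the cofactor.
\<close>
lemma cofactor_root_norm:
  assumes kl: "k > 0" "l > 0" "coprime k l" and root: "poly (cofactor k l) z = 0"
  shows "norm z \<noteq> 1"
proof
  assume norm: "norm z = 1"
  have z0: "z \<noteq> 0" using norm by auto
  have "z \<noteq> 1"
  proof
    assume "z = 1"
    then have "of_nat (k\<^sup>2 + l\<^sup>2) = (0 :: complex)"
      using root unfolding \<open>z = 1\<close> poly_cofactor_1 by (simp only: neg_equal_0_iff_equal)
    then show False using kl by (subst (asm) of_nat_eq_0_iff) simp
  qed
  have "P_laurent k l z = 0"
    using P_laurent_cofactor[OF z0, of k l] root z0 by simp
  moreover have factor: "3 - z ^ m - z powi (- int m) = of_real (1 + (2 - 2 * Re (z ^ m)))" for m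
  proof -
    have "z powi (- int m) = cnj (z ^ m)"
      using norm z0 by (simp add: power_int_minus inverse_eq_divide complex_div_cnj[of 1] norm_power)
    then show ?thesis
      using complex_add_cnj[of "z ^ m"] by (simp add: algebra_simps)
  qed
  ultimately have "of_real ((1 + (2 - 2 * Re (z ^ k))) * (1 + (2 - 2 * Re (z ^ l)))) = (1 :: complex)"
    unfolding P_laurent_def by simp
  then have eq: "(1 + (2 - 2 * Re (z ^ k))) * (1 + (2 - 2 * Re (z ^ l))) = 1"
    using of_real_eq_1_iff by blast
  have nonneg: "2 - 2 * Re (z ^ m) \<ge> 0" for m
    using complex_Re_le_cmod[of "z ^ m"] norm by (simp add: norm_power)
  define a b where "a = 2 - 2 * Re (z ^ k)" and "b = 2 - 2 * Re (z ^ l)"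
  have "a \<ge> 0" "b \<ge> 0" "a + b + a * b = 0"
    using nonneg[of k] nonneg[of l] eq by (simp_all add: a_def b_def algebra_simps)
  then have "a = 0" "b = 0"
    using mult_nonneg_nonneg[of a b] by linarith+
  moreover have "w = 1" if "norm w = 1" "Re w = 1" for w
    using that by (simp add: cmod_def complex_eq_iff)
  ultimately have one: "z ^ k = 1" "z ^ l = 1"
    using norm by (simp_all add: a_def b_def norm_power)
  obtain x y where "k * x = l * y + 1"
    using bezout_nat[of k l] kl by auto
  then have "z ^ (k * x) = z ^ (l * y + 1)" by simp
  then have "z = 1"
    using one by (simp add: power_mult)
  then show False using \<open>z \<noteq> 1\<close> by contradiction
qed

lemma P_laurent_eq_0_iff:
  assumes "norm z > 1"
  shows "P_laurent k l z = 0 \<longleftrightarrow> poly (cofactor k l) z = 0"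
proof -
  have "z \<noteq> 0" "z \<noteq> 1" using assms by auto
  then show ?thesis
    using P_laurent_cofactor[of z k l] by auto
qed

text \<open>
  Away from 0 and 1 the quotient \<open>(z - 1)\<^sup>2 / z ^ (k + l)\<close> of \<open>P\<close> by its cofactor is holomorphic
  and nonzero, so it does not change the multiplicity of a root.
\<close>
lemma zorder_P_laurent:
  assumes kl: "k > 0" "l > 0" and z: "norm z > 1"
  shows "zorder (P_laurent k l) z = int (order z (cofactor k l))"
proof -
  let ?m = "order z (cofactor k l)"
  have "cofactor k l \<noteq> 0"
    using lead_coeff_cofactor[OF kl] by auto
  then obtain S where S: "cofactor k l = [:-z, 1:] ^ ?m * S" "\<not> [:-z, 1:] dvd S"
    using order_decomp by blast
  show ?thesis
  proof (rule zorder_eqI[where S = "-{0}" and g = "\<lambda>w. (w - 1)\<^sup>2 * poly S w / w ^ (k + l)"])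
    have "poly S z \<noteq> 0" using S(2) by (simp add: poly_eq_0_iff_dvd)
    then show "(z - 1)\<^sup>2 * poly S z / z ^ (k + l) \<noteq> 0" using z by auto
    fix w :: complex assume "w \<in> -{0}"
    then have "P_laurent k l w = (w - 1)\<^sup>2 * poly (cofactor k l) w / w ^ (k + l)"
      using P_laurent_cofactor[of w k l] by (simp add: field_simps)
    then show "P_laurent k l w = (w - 1)\<^sup>2 * poly S w / w ^ (k + l) * (w - z) powi int ?m"
      by (subst (asm) S(1)) (simp add: mult_ac)
  qed (use z in \<open>auto intro!: holomorphic_intros\<close>)
qed

lemma A_const_eq:
  assumes "k > 0" "l > 0"
  shows "A_const k l = (\<Prod>z | poly (cofactor k l) z = 0 \<and> norm z > 1. norm z ^ order z (cofactor k l))"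
  unfolding A_const_def
  by (intro prod.cong) (auto simp: P_laurent_eq_0_iff zorder_P_laurent[OF assms])

lemma poly_cofactor_prod:
  assumes "k > 0" "l > 0"
  shows "poly (cofactor k l) w = (\<Prod>z | poly (cofactor k l) z = 0. (w - z) ^ order z (cofactor k l))"
proof -
  let ?R = "cofactor k l"
  have "?R = (\<Prod>z | poly ?R z = 0. [:-z, 1:] ^ order z ?R)"
    using complex_poly_decompose[of ?R] lead_coeff_cofactor[OF assms] by simp
  from arg_cong[OF this, of "\<lambda>p. poly p w"] show ?thesis
    by (simp add: poly_prod)
qed

section \<open>The asymptotic growth\<close>

text \<open>
  Exchange the products over the roots of unity and over the roots of the cofactor. Absolute values
  remove the unimodular factor \<open>\<omega> ^ (k + l)\<close> between \<open>P(\<omega>)\<close> and \<open>\<omega> ^ (k + l) * P(\<omega>)\<close>, and the signs of the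
  differences.
\<close>
lemma tau_eq_cofactor_roots:
  assumes kl: "k > 0" "l > 0" and n: "n > 0"
  shows "real (tau k l n) = real n *
    (\<Prod>z | poly (cofactor k l) z = 0. norm (poly (geo_poly n) z) ^ order z (cofactor k l))"
proof -
  let ?R = "cofactor k l"
  have P: "norm (P_laurent k l w) = norm (1 - w) ^ 2 * (\<Prod>z | poly ?R z = 0. norm (z - w) ^ order z ?R)"
    if "norm w = 1" for w
  proof -
    have "w \<noteq> 0" using that by auto
    from arg_cong[OF P_laurent_cofactor[OF this, of k l], of norm]
    have "norm (P_laurent k l w) = norm (1 - w) ^ 2 * norm (poly ?R w)"
      using that by (simp add: norm_mult norm_power norm_minus_commute)
    also have "norm (poly ?R w) = (\<Prod>z | poly ?R z = 0. norm (z - w) ^ order z ?R)"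
      by (subst poly_cofactor_prod[OF kl])
        (simp only: prod_norm[symmetric] norm_power norm_minus_commute[of w])
    finally show ?thesis .
  qed
  have root_prod: "(\<Prod>j\<in>{0<..<n}. norm (z - unity_root n j)) = norm (poly (geo_poly n) z)" for z
    by (simp add: prod_norm prod_unity_roots[OF n])
  have "real (n * tau k l n) = norm (of_nat (n * tau k l n) :: complex)"
    by (simp only: norm_of_nat)
  also have "\<dots> = (\<Prod>j\<in>{0<..<n}. norm (P_laurent k l (unity_root n j)))"
    by (simp only: tau_eq_prod[OF n] prod_norm)
  also have "\<dots> = (\<Prod>j\<in>{0<..<n}. norm (1 - unity_root n j) ^ 2 *
      (\<Prod>z | poly ?R z = 0. norm (z - unity_root n j) ^ order z ?R))"
    by (intro prod.cong refl P) simp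
  also have "\<dots> = (\<Prod>j\<in>{0<..<n}. norm (1 - unity_root n j)) ^ 2 *
      (\<Prod>z | poly ?R z = 0. (\<Prod>j\<in>{0<..<n}. norm (z - unity_root n j)) ^ order z ?R)"
    unfolding prod.distrib prod_power_distrib by (subst prod.swap) (rule refl)
  also have "\<dots> = (real n)\<^sup>2 * (\<Prod>z | poly ?R z = 0. norm (poly (geo_poly n) z) ^ order z ?R)"
    by (simp only: root_prod poly_geo_1 norm_of_nat)
  finally show ?thesis using n by (simp add: power2_eq_square)
qed

lemma geo_growth:
  assumes "norm z \<noteq> 1"
  shows "(\<lambda>n. norm (poly (geo_poly n) z) / (if norm z > 1 then norm z else 1) ^ n)
           \<longlonglongrightarrow> 1 / norm (1 - z)"
proof -
  have "z \<noteq> 1" using assms by auto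
  then have geo_eq: "poly (geo_poly n) z = (z ^ n - 1) / (z - 1)" for n
    using mult_poly_geo[of z n] by (simp add: field_simps)
  have "(\<lambda>n. norm (z ^ n - 1) / (if norm z > 1 then norm z else 1) ^ n) \<longlonglongrightarrow> 1"
  proof (cases "norm z > 1")
    case True
    then have "z \<noteq> 0" by auto
    have "(\<lambda>n. norm (1 - inverse z ^ n)) \<longlonglongrightarrow> norm (1 - 0 :: complex)"
      using True by (intro tendsto_intros LIMSEQ_power_zero) (simp add: norm_inverse inverse_less_1_iff)
    moreover have "norm (1 - inverse z ^ n) = norm (z ^ n - 1) / norm z ^ n" for n
    proof -
      have "1 - inverse z ^ n = (z ^ n - 1) / z ^ n"
        using \<open>z \<noteq> 0\<close> by (simp add: field_simps)
      then show ?thesis by (simp add: norm_divide norm_power)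
    qed
    ultimately show ?thesis using True by simp
  next
    case False
    then have "(\<lambda>n. norm (z ^ n - 1)) \<longlonglongrightarrow> norm (0 - 1 :: complex)"
      using assms by (intro tendsto_intros LIMSEQ_power_zero) simp
    then show ?thesis using False by simp
  qed
  then have "(\<lambda>n. norm (z ^ n - 1) / (if norm z > 1 then norm z else 1) ^ n / norm (z - 1))
      \<longlonglongrightarrow> 1 / norm (z - 1)"
    using \<open>z \<noteq> 1\<close> by (intro tendsto_divide) auto
  then show ?thesis
    by (simp add: geo_eq norm_divide norm_minus_commute mult_ac)
qed

text \<open>
  Dividing each root's contribution by its growth rate leaves \<open>1 / \<bar>1 - z\<bar>\<close> in the limit. The product of
  these limits is \<open>1 / \<bar>R(1)\<bar> = 1 / (k\<^sup>2 + l\<^sup>2)\<close>.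
\<close>
theorem theorem6p1:
  fixes k l :: nat
  assumes "k > 0" and "l > 0" and "coprime k l"
  shows "(\<lambda>n. real (tau k l n)) \<sim>[at_top] (\<lambda>n. real n / real (k\<^sup>2 + l\<^sup>2) * A_const k l ^ n)"
proof (rule asymp_equivI')
  let ?R = "cofactor k l"
  let ?Z = "{z. poly ?R z = 0}"
  let ?m = "\<lambda>z. order z ?R"
  let ?b = "\<lambda>z. if norm z > 1 then norm z else 1"
  have R0: "?R \<noteq> 0" using lead_coeff_cofactor[OF assms(1,2)] by auto
  then have fin: "finite ?Z" by (rule poly_roots_finite)
  have A: "A_const k l = (\<Prod>z\<in>?Z. ?b z ^ ?m z)"
    unfolding A_const_eq[OF assms(1,2)] using fin
    by (intro prod.mono_neutral_cong_left) auto
  have ratio: "real (tau k l n) / (real n / real (k\<^sup>2 + l\<^sup>2) * A_const k l ^ n) =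
      real (k\<^sup>2 + l\<^sup>2) * (\<Prod>z\<in>?Z. (norm (poly (geo_poly n) z) / ?b z ^ n) ^ ?m z)" if "n > 0" for n
  proof -
    have "A_const k l ^ n = (\<Prod>z\<in>?Z. (?b z ^ n) ^ ?m z)"
      unfolding A prod_power_distrib power_mult[symmetric] by (simp only: mult.commute)
    then show ?thesis
      unfolding tau_eq_cofactor_roots[OF assms(1,2) that] power_divide prod_dividef
      using that by simp
  qed
  have "(\<lambda>n. real (k\<^sup>2 + l\<^sup>2) * (\<Prod>z\<in>?Z. (norm (poly (geo_poly n) z) / ?b z ^ n) ^ ?m z))
      \<longlonglongrightarrow> real (k\<^sup>2 + l\<^sup>2) * (\<Prod>z\<in>?Z. (1 / norm (1 - z)) ^ ?m z)"
    by (intro tendsto_mult tendsto_const tendsto_prod tendsto_power geo_growth)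
       (use cofactor_root_norm[OF assms] in auto)
  also have "(\<Prod>z\<in>?Z. (1 / norm (1 - z)) ^ ?m z) = 1 / norm (poly ?R 1)"
  proof -
    have "poly ?R 1 = (\<Prod>z\<in>?Z. (1 - z) ^ ?m z)"
      by (rule poly_cofactor_prod[OF assms(1,2)])
    then show ?thesis
      by (simp add: prod_norm[symmetric] norm_power power_divide prod_dividef)
  qed
  also have "real (k\<^sup>2 + l\<^sup>2) * (1 / norm (poly ?R 1)) = 1"
    unfolding poly_cofactor_1 norm_minus_cancel norm_of_nat using assms(1) by simp
  finally show "(\<lambda>n. real (tau k l n) / (real n / real (k\<^sup>2 + l\<^sup>2) * A_const k l ^ n)) \<longlonglongrightarrow> 1"
    by (rule Lim_transform_eventually)
       (use ratio in \<open>auto simp: eventually_at_top_linorder intro!: exI[of _ 1]\<close>)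
qed

end
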